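(* Let $f:\mathbb{R}\to\mathbb{C}$ be a function such that: (i) $f\in L^2(\mathbb{R})+\mathbb{C}\cdot 1$; (ii) $|f|$ is bounded and bounded away from zero; (iii) $f^\lambda$ is positive definite for all real $\lambda>0$. Then $f=\Phi_+\Phi_-$, where $\Phi_+$ is positive definite on $\mathbb{R}$ and extends to a bounded holomorphic function on the upper half plane, and $\Phi_-$ is positive definite on $\mathbb{R}$ and extends to a bounded holomorphic function on the lower half plane.
   Context: Positive definiteness: a function $f$ on the real line is called positive definite if its Fourier transform exists everywhere and takes non-negative real values; this is used interchangeably with Bochner's criterion, that for every finite set of points $x_1,\dots,x_m\in\mathbb{R}$ the matrix $[f(x_i-x_j)]$ is positive semi-definite (Hermitian with non-negative eigenvalues). In particular, non-negative constants are positive definite in this sense. $L^2(\mathbb{R})+\mathbb{C}\cdot 1$ denotes the set of functions that are the sum of a square-integrable function and a constant. $f^\lambda$ means $\exp(\lambda\log f)$, for one branch $\log f$ of the logarithm of $f$ along $\mathbb{R}$, used for all $\lambda$. *)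

theory Defs
  imports "HOL-Complex_Analysis.Complex_Analysis" "Jordan_Normal_Form.Schur_Decomposition"
begin

definition positive_semidefinite_mat :: "complex mat \<Rightarrow> bool" where
  "positive_semidefinite_mat A \<longleftrightarrow>
     square_mat A \<and> mat_adjoint A = A \<and> (\<forall>k. eigenvalue A k \<longrightarrow> k \<in> \<real>\<^sub>\<ge>\<^sub>0)"

(* Positive definiteness in the sense of Bochner's criterion; continuity is not part of it. *)
definition positive_definite_fun :: "(real \<Rightarrow> complex) \<Rightarrow> bool" where
  "positive_definite_fun f \<longleftrightarrow>
     (\<forall>xs. distinct xs \<longrightarrow>
        positive_semidefinite_mat
          (mat (length xs) (length xs) (\<lambda>(i, j). f (xs ! i - xs ! j))))"

definition L2_fun :: "(real \<Rightarrow> complex) \<Rightarrow> bool" where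
  "L2_fun g \<longleftrightarrow> g \<in> borel_measurable lebesgue \<and> integrable lebesgue (\<lambda>x. (cmod (g x))\<^sup>2)"

definition L2_plus_const_fun :: "(real \<Rightarrow> complex) \<Rightarrow> bool" where
  "L2_plus_const_fun f \<longleftrightarrow> (\<exists>g c. L2_fun g \<and> (\<forall>x. f x = g x + c))"

(* A branch along the real line is a continuous choice of logarithm. *)
definition log_branch :: "(real \<Rightarrow> complex) \<Rightarrow> (real \<Rightarrow> complex) \<Rightarrow> bool" where
  "log_branch f L \<longleftrightarrow> continuous_on UNIV L \<and> (\<forall>x. exp (L x) = f x)"

(* The power of f with exponent r, formed with the branch L of log f. *)
definition branch_power :: "(real \<Rightarrow> complex) \<Rightarrow> real \<Rightarrow> real \<Rightarrow> complex" where
  "branch_power L r x = exp (of_real r * L x)"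

(* Boundary values on the real line are attained continuously. *)
definition bounded_holomorphic_ext_upper :: "(real \<Rightarrow> complex) \<Rightarrow> bool" where
  "bounded_holomorphic_ext_upper \<phi> \<longleftrightarrow>
     (\<exists>F. continuous_on {z. 0 \<le> Im z} F \<and> F holomorphic_on {z. 0 < Im z} \<and>
          bounded (F ` {z. 0 < Im z}) \<and> (\<forall>x. F (complex_of_real x) = \<phi> x))"

definition bounded_holomorphic_ext_lower :: "(real \<Rightarrow> complex) \<Rightarrow> bool" where
  "bounded_holomorphic_ext_lower \<phi> \<longleftrightarrow>
     (\<exists>F. continuous_on {z. Im z \<le> 0} F \<and> F holomorphic_on {z. Im z < 0} \<and>
          bounded (F ` {z. Im z < 0}) \<and> (\<forall>x. F (complex_of_real x) = \<phi> x))"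

end

theory Submission
  imports Defs
begin

text \<open>
  Differentiating \<open>exp (r * L)\<close> at \<open>r = 0\<close> shows that \<open>L\<close> is conditionally positive definite.
  Since its real part is bounded, its imaginary part is additive up to a bounded error, so
  \<open>L x = \<i> * \<beta> * x + \<psi> x\<close> with \<open>\<psi>\<close> bounded and conditionally positive definite.
  In Levy--Khintchine terms \<open>\<psi>\<close> is a constant plus the Fourier transform of a finite positive measure,
  and the factors are the exponentials of its restrictions to the two half lines; the drift \<open>\<beta>\<close> joins
  the half line given by its sign. No measure is constructed: Fejer means of \<open>\<psi>\<close> over finite
  cyclic groups approximate it by finite sums \<open>\<Sum>w * exp (\<i> * s * z)\<close> with \<open>w \<ge> 0\<close>. The part with \<open>s > 0\<close> is
  bounded on the upper half plane, and continuity of \<open>\<psi>\<close> at the origin makes the weights tight, hence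
  the sums uniformly equicontinuous up to the boundary. A convergent subsequence gives the
  holomorphic extension.
\<close>

section \<open>Positive definiteness through quadratic forms\<close>

text \<open>Cutting the spectrum of a bounded function at zero is in general not bounded for the
  supremum norm, so size estimates for \<psi> alone do not control the two halves. The sign of the
  weights rescues the cut: where they are nonnegative, each half is bounded by its total weight, and
  all weights together add up to the value at the origin. The single weight without a sign sits at
  frequency zero. It is merely bounded, and survives as a real constant \<open>c\<close> whose
  exponential is positive whatever the sign of \<open>c\<close>. Weight that drifts to frequency
  zero in the limit may end up in either half, which is harmless because constants extend to both
  half planes. Two scales must be balanced: the mesh 1 / (k + 1) has to become fine, while the
  cyclic group must be long enough for wrap-around at a fixed point to disappear. An order of about
  2 * (k + 1)^2 achieves both.\<close>

definition toeplitz_form :: "(real \<Rightarrow> complex) \<Rightarrow> nat \<Rightarrow> (nat \<Rightarrow> real) \<Rightarrow> (nat \<Rightarrow> complex) \<Rightarrow> complex" where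
  "toeplitz_form f n x c = (\<Sum>i<n. \<Sum>j<n. cnj (c i) * c j * f (x i - x j))"

section \<open>Hermitian forms in finitely many coordinates and their smallest eigenvalue\<close>

definition sesquilinear_form :: "(nat \<Rightarrow> nat \<Rightarrow> complex) \<Rightarrow> nat \<Rightarrow> (nat \<Rightarrow> complex) \<Rightarrow> (nat \<Rightarrow> complex) \<Rightarrow> complex" where
  "sesquilinear_form A n v w = (\<Sum>i<n. cnj (v i) * (\<Sum>j<n. A i j * w j))"

lemma sesquilinear_form_add_left: "sesquilinear_form A n (\<lambda>i. u i + v i) w = sesquilinear_form A n u w + sesquilinear_form A n v w"
  by (simp add: sesquilinear_form_def algebra_simps sum.distrib)

lemma sesquilinear_form_add_right: "sesquilinear_form A n u (\<lambda>i. v i + w i) = sesquilinear_form A n u v + sesquilinear_form A n u w"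
  by (simp add: sesquilinear_form_def algebra_simps sum.distrib sum_distrib_left)

lemma sesquilinear_form_scale_left: "sesquilinear_form A n (\<lambda>i. a * v i) w = cnj a * sesquilinear_form A n v w"
  by (simp add: sesquilinear_form_def algebra_simps sum_distrib_left)

lemma sesquilinear_form_scale_right: "sesquilinear_form A n v (\<lambda>i. a * w i) = a * sesquilinear_form A n v w"
  by (simp add: sesquilinear_form_def algebra_simps sum_distrib_left)

lemma sesquilinear_form_hermitian:
  assumes "\<And>i j. i < n \<Longrightarrow> j < n \<Longrightarrow> A j i = cnj (A i j)"
  shows "sesquilinear_form A n w v = cnj (sesquilinear_form A n v w)"
proof -
  have "sesquilinear_form A n w v = (\<Sum>i<n. \<Sum>j<n. cnj (w i) * (A i j * v j))"
    by (simp add: sesquilinear_form_def sum_distrib_left)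
  also have "\<dots> = (\<Sum>j<n. \<Sum>i<n. cnj (w i) * (A i j * v j))"
    by (rule sum.swap)
  also have "\<dots> = (\<Sum>j<n. \<Sum>i<n. cnj (cnj (v j) * (A j i * w i)))"
  proof (intro sum.cong refl)
    fix i j assume "j \<in> {..<n}" "i \<in> {..<n}"
    then have "A i j = cnj (A j i)" by (intro assms) auto
    then show "cnj (w i) * (A i j * v j) = cnj (cnj (v j) * (A j i * w i))" by simp
  qed
  also have "\<dots> = cnj (sesquilinear_form A n v w)"
    by (simp add: sesquilinear_form_def sum_distrib_left)
  finally show ?thesis .
qed

text \<open>A polynomial that vanishes at 0 and is nonnegative everywhere has a minimum at 0, so its
  derivative there is zero. This serves as the first-order condition at the minimiser of a quadratic
  form.\<close>

lemma linear_coeff_zero: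
  fixes a b :: real
  assumes "\<And>t. 0 \<le> 2 * t * a + t\<^sup>2 * b"
  shows "a = 0"
proof (rule ccontr)
  assume a: "a \<noteq> 0"
  \<comment> \<open>This is the minimiser once \<open>b\<close> is replaced by the strictly positive
    upper bound \<open>\<bar>b\<bar> + 1\<close>.\<close>
  define t where "t = - a / (\<bar>b\<bar> + 1)"
  have "2 * t * a + t\<^sup>2 * b \<le> 2 * t * a + t\<^sup>2 * (\<bar>b\<bar> + 1)"
    by (intro add_left_mono mult_left_mono) auto
  also have "\<dots> = - (a\<^sup>2 / (\<bar>b\<bar> + 1))"
    by (simp add: t_def power2_eq_square divide_simps)
  also have "\<dots> < 0"
    using a by (auto intro!: divide_pos_pos)
  finally show False using assms[of t] by linarith
qed

text \<open>The minimiser of the Rayleigh quotient is an eigenvector for its minimum.\<close>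

lemma hermitian_form_nonneg:
  assumes herm: "\<And>i j. i < n \<Longrightarrow> j < n \<Longrightarrow> A j i = cnj (A i j)"
    and ev: "\<And>v l. \<exists>i<n. v i \<noteq> 0 \<Longrightarrow> \<forall>i<n. (\<Sum>j<n. A i j * v j) = complex_of_real l * v i \<Longrightarrow> 0 \<le> l"
  shows "0 \<le> Re (sesquilinear_form A n v v)"
proof -
  define q where "q v = Re (sesquilinear_form A n v v)" for v
  define N where "N v = (\<Sum>i<n. (cmod (v i))\<^sup>2)" for v :: "nat \<Rightarrow> complex"
  \<comment> \<open>The unit sphere in the first \<open>n\<close> coordinates. The remaining
    coordinates are free, and neither \<open>q\<close> nor \<open>N\<close> sees them.\<close>
  define K where "K = {v. N v = 1}"
  have q_scale: "q (\<lambda>i. complex_of_real a * v i) = a\<^sup>2 * q v" for a v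
    by (simp add: q_def sesquilinear_form_scale_left sesquilinear_form_scale_right power2_eq_square)
  have N_scale: "N (\<lambda>i. complex_of_real a * v i) = a\<^sup>2 * N v" for a v
    by (simp add: N_def norm_mult power_mult_distrib sum_distrib_left)
  have N0: "N v \<ge> 0" for v by (simp add: N_def sum_nonneg)
  have N_zero: "N v = 0 \<longleftrightarrow> (\<forall>i<n. v i = 0)" for v
    by (simp add: N_def sum_nonneg_eq_0_iff) auto
  have q_zero: "q v = 0" if "\<forall>i<n. v i = 0" for v
    using that by (simp add: q_def sesquilinear_form_def)
  have bnd: "cmod (v i) \<le> 1" if "v \<in> K" "i < n" for v i
  proof -
    have "(cmod (v i))\<^sup>2 \<le> N v" unfolding N_def
      by (rule member_le_sum) (use that in auto)
    with that show ?thesis by (simp add: K_def abs_square_le_1)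
  qed
  have qbnd: "- (\<Sum>i<n. \<Sum>j<n. cmod (A i j)) \<le> q v" if "v \<in> K" for v
  proof -
    have "cmod (sesquilinear_form A n v v) \<le> (\<Sum>i<n. \<Sum>j<n. cmod (A i j))"
      unfolding sesquilinear_form_def sum_distrib_left
    proof (intro sum_norm_le)
      fix i j assume "i \<in> {..<n}" "j \<in> {..<n}"
      then have "cmod (v i) * (cmod (A i j) * cmod (v j)) \<le> 1 * (cmod (A i j) * 1)"
        using bnd[OF that] by (intro mult_mono) auto
      then show "cmod (cnj (v i) * (A i j * v j)) \<le> cmod (A i j)" by (simp add: norm_mult)
    qed
    moreover have "\<bar>q v\<bar> \<le> cmod (sesquilinear_form A n v v)" unfolding q_def by (rule abs_Re_le_cmod)
    ultimately show ?thesis by linarith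
  qed
  have "0 \<le> q v"
  \<comment> \<open>The sphere is empty exactly when \<open>n\<close> is 0, and then the infimum
    below would carry no information.\<close>
  proof (cases "K = {}")
    case True
    have "N v = 0"
    proof (rule ccontr)
      assume "N v \<noteq> 0"
      then have "(\<lambda>i. complex_of_real (1 / sqrt (N v)) * v i) \<in> K"
        unfolding K_def mem_Collect_eq N_scale using N0[of v] by (simp add: power_divide)
      with True show False by blast
    qed
    then show ?thesis using q_zero N_zero by simp
  next
    case False
    define l where "l = Inf (q ` K)"
    have bb: "bdd_below (q ` K)" by (rule bdd_belowI2[OF qbnd])
    have lq: "l \<le> q v" if "v \<in> K" for v
      unfolding l_def by (rule cInf_lower) (use that bb in auto)
    have "\<exists>v\<in>K. q v < l + inverse (real (Suc k))" for k
    proof -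
      have "Inf (q ` K) < l + inverse (real (Suc k))" by (simp add: l_def)
      then show ?thesis using cInf_lessD[of "q ` K"] False by auto
    qed
    then obtain V where V: "\<And>k. V k \<in> K" "\<And>k. q (V k) < l + inverse (real (Suc k))"
      by metis
    \<comment> \<open>Compactness of the sphere in sequential form: a minimising sequence has
      coordinates bounded by 1, and coordinatewise convergence suffices because \<open>N\<close> and
      \<open>q\<close> are finite sums.\<close>
    obtain r where r: "strict_mono (r :: nat \<Rightarrow> nat)"
      "\<And>i. i \<in> {..<n} \<Longrightarrow> \<exists>y. (\<lambda>k. V (r k) i) \<longlonglongrightarrow> y"
      using function_convergent_subsequence[of "{..<n}" V 1] bnd V(1) by (metis countable_finite finite_lessThan lessThan_iff)
    then obtain u where u: "\<And>i. i < n \<Longrightarrow> (\<lambda>k. V (r k) i) \<longlonglongrightarrow> u i"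
      by (metis lessThan_iff)
    have "(\<lambda>k. N (V (r k))) \<longlonglongrightarrow> N u"
      unfolding N_def by (intro tendsto_intros) (use u in auto)
    moreover have "N (V (r k)) = 1" for k using V(1) by (simp add: K_def)
    ultimately have Nu: "N u = 1" by (simp add: LIMSEQ_const_iff)
    have "(\<lambda>k. q (V (r k))) \<longlonglongrightarrow> q u"
      unfolding q_def sesquilinear_form_def by (intro tendsto_intros) (use u in auto)
    moreover have "(\<lambda>k. l + inverse (real (Suc (r k)))) \<longlonglongrightarrow> l + 0"
      by (intro tendsto_intros LIMSEQ_subseq_LIMSEQ[OF LIMSEQ_inverse_real_of_nat r(1), unfolded o_def])
    ultimately have "q u \<le> l + 0"
      by (rule LIMSEQ_le) (use V(2) less_imp_le in blast)
    with lq[of u] Nu have qu: "q u = l" by (simp add: K_def)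
    have lqN: "l * N v \<le> q v" for v
    proof (cases "N v = 0")
      case True
      then have "q v = 0" using q_zero[of v] N_zero[of v] by blast
      with True show ?thesis by simp
    next
      case False
      then have Nv: "N v > 0" using N0[of v] by simp
      have "(\<lambda>i. complex_of_real (1 / sqrt (N v)) * v i) \<in> K"
        unfolding K_def mem_Collect_eq N_scale using Nv by (simp add: power_divide)
      from lq[OF this] have "l \<le> q v / N v"
        unfolding q_scale using Nv by (simp add: power_divide)
      then show ?thesis using Nv by (simp add: field_simps)
    qed
    \<comment> \<open>Shifting by \<open>l\<close> makes the form nonnegative and zero at
      \<open>u\<close>. Moving \<open>u\<close> in the direction \<open>w\<close>, the image of
      \<open>u\<close> under \<open>B\<close>, gives a polynomial without constant term whose linear
      coefficient is twice \<open>N w\<close>. Its vanishing is the eigenvector equation.\<close>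
    define B where "B = (\<lambda>i j. A i j - (if i = j then complex_of_real l else 0))"
    have Bv: "(\<Sum>j<n. B i j * v j) = (\<Sum>j<n. A i j * v j) - complex_of_real l * v i" if "i < n" for i v
    proof -
      have "(\<Sum>j<n. B i j * v j) = (\<Sum>j<n. A i j * v j - (if i = j then complex_of_real l * v j else 0))"
        by (intro sum.cong) (auto simp: B_def algebra_simps)
      then show ?thesis using that by (simp add: sum_subtractf)
    qed
    have Bherm: "B j i = cnj (B i j)" if "i < n" "j < n" for i j
      using herm[OF that] by (simp add: B_def)
    have BN: "Re (sesquilinear_form B n v v) = q v - l * N v" for v
    proof -
      have "sesquilinear_form B n v v = (\<Sum>i<n. cnj (v i) * ((\<Sum>j<n. A i j * v j) - complex_of_real l * v i))"
        unfolding sesquilinear_form_def by (intro sum.cong refl) (simp add: Bv)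
      also have "\<dots> = sesquilinear_form A n v v - (\<Sum>i<n. complex_of_real l * (v i * cnj (v i)))"
        by (simp add: sesquilinear_form_def algebra_simps sum_subtractf)
      also have "(\<Sum>i<n. complex_of_real l * (v i * cnj (v i))) = complex_of_real (l * N v)"
        by (simp add: N_def complex_norm_square sum_distrib_left del: of_real_power)
      finally show ?thesis by (simp add: q_def)
    qed
    define w where "w i = (\<Sum>j<n. B i j * u j)" for i
    have "Re (sesquilinear_form B n w u) = 0"
    proof (rule linear_coeff_zero)
      fix t :: real
      let ?z = "\<lambda>i. u i + complex_of_real t * w i"
      have "0 \<le> Re (sesquilinear_form B n ?z ?z)" using BN lqN by simp
      also have "sesquilinear_form B n ?z ?z = sesquilinear_form B n u u + of_real t * (sesquilinear_form B n w u + cnj (sesquilinear_form B n w u))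
         + of_real (t\<^sup>2) * sesquilinear_form B n w w"
        by (simp add: sesquilinear_form_add_left sesquilinear_form_add_right sesquilinear_form_scale_left sesquilinear_form_scale_right power2_eq_square
            sesquilinear_form_hermitian[of n B u w, OF Bherm] algebra_simps)
      also have "Re \<dots> = 2 * t * Re (sesquilinear_form B n w u) + t\<^sup>2 * Re (sesquilinear_form B n w w)"
        by (simp add: BN qu Nu del: of_real_power)
      finally show "0 \<le> 2 * t * Re (sesquilinear_form B n w u) + t\<^sup>2 * Re (sesquilinear_form B n w w)" .
    qed
    moreover have "sesquilinear_form B n w u = complex_of_real (N w)"
      unfolding sesquilinear_form_def w_def[symmetric] N_def
      by (simp add: complex_norm_square mult.commute del: of_real_power)
    ultimately have "N w = 0" by simp
    then have "\<forall>i<n. (\<Sum>j<n. A i j * u j) = complex_of_real l * u i"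
      using N_zero Bv by (auto simp: w_def)
    moreover have "\<exists>i<n. u i \<noteq> 0" using Nu N_zero[of u] by auto
    ultimately have "0 \<le> l" by (rule ev[rotated])
    then show ?thesis using lqN[of v] N0[of v] by (meson mult_nonneg_nonneg order_trans)
  qed
  then show ?thesis by (simp add: q_def)
qed

section \<open>Translation between matrices with eigenvalues and quadratic forms\<close>

lemma mat_adjoint_eq_self_iff:
  assumes "A \<in> carrier_mat n n"
  shows "mat_adjoint A = A \<longleftrightarrow> (\<forall>i<n. \<forall>j<n. A $$ (j, i) = cnj (A $$ (i, j)))"
proof -
  have 1: "mat_adjoint A \<in> carrier_mat n n" using assms by (intro carrier_matI) (simp_all add: mat_adjoint_def)
  have 2: "mat_adjoint A $$ (j, i) = cnj (A $$ (i, j))" if "i < n" "j < n" for i j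
    using assms that by (simp add: mat_adjoint_def mat_of_rows_index)
  show ?thesis
  proof
    assume e: "mat_adjoint A = A"
    show "\<forall>i<n. \<forall>j<n. A $$ (j, i) = cnj (A $$ (i, j))"
      using 2[unfolded e] by blast
  next
    assume *: "\<forall>i<n. \<forall>j<n. A $$ (j, i) = cnj (A $$ (i, j))"
    show "mat_adjoint A = A"
    proof (rule eq_matI)
      fix i j assume "i < dim_row A" "j < dim_col A"
      then have ij: "i < n" "j < n" using assms by auto
      show "mat_adjoint A $$ (i, j) = A $$ (i, j)"
        unfolding 2[OF ij(2,1)] by (rule *[rule_format, OF ij(2,1), symmetric])
    qed (use 1 assms in auto)
  qed
qed

lemma eigenvalue_iff_sum:
  assumes "A \<in> carrier_mat n n"
  shows "eigenvalue A k \<longleftrightarrow> (\<exists>v. (\<exists>i<n. v i \<noteq> 0) \<and> (\<forall>i<n. (\<Sum>j<n. A $$ (i, j) * v j) = k * v i))"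
    (is "_ \<longleftrightarrow> ?R")
proof
  assume "eigenvalue A k"
  then obtain v where v: "v \<in> carrier_vec n" "v \<noteq> 0\<^sub>v n" "A *\<^sub>v v = k \<cdot>\<^sub>v v"
    using assms by (auto simp: eigenvalue_def eigenvector_def)
  have "\<exists>i<n. vec_index v i \<noteq> 0"
    using v(1,2) by (metis carrier_vecD eq_vecI index_zero_vec)
  moreover have "(\<Sum>j<n. A $$ (i, j) * vec_index v j) = k * vec_index v i" if "i < n" for i
  proof -
    have "vec_index (A *\<^sub>v v) i = (\<Sum>j<n. A $$ (i, j) * vec_index v j)"
      using that assms v(1) by (auto simp: scalar_prod_def lessThan_atLeast0 intro!: sum.cong)
    then show ?thesis using v(1) that by (simp add: v(3))
  qed
  ultimately show ?R by blast
next
  assume ?R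
  then obtain v where v: "\<exists>i<n. v i \<noteq> 0" "\<forall>i<n. (\<Sum>j<n. A $$ (i, j) * v j) = k * v i" by blast
  have "vec n v \<noteq> 0\<^sub>v n" using v(1) by (metis index_vec index_zero_vec(1))
  moreover have "A *\<^sub>v vec n v = k \<cdot>\<^sub>v vec n v"
    by (rule eq_vecI) (use v(2) assms in \<open>auto simp: scalar_prod_def lessThan_atLeast0 intro!: sum.cong\<close>)
  ultimately show "eigenvalue A k"
    unfolding eigenvalue_def eigenvector_def using assms by (intro exI[of _ "vec n v"]) auto
qed

text \<open>Polarisation on two points: with a real diagonal, reality of the form at (1, 1) makes
  the imaginary parts cancel, and reality at (1, \<i>) makes the real parts agree.\<close>

lemma toeplitz_form_nonneg_imp_hermitian:
  assumes "\<And>c. toeplitz_form f 2 ((!) [0, x]) c \<in> \<real>\<^sub>\<ge>\<^sub>0" and "f 0 \<in> \<real>"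
  shows "f (- x) = cnj (f x)"
proof -
  have two: "toeplitz_form f 2 ((!) [0, x]) ((!) [a, b]) = cnj a * a * f 0 + cnj a * b * f (-x)
     + (cnj b * a * f x + cnj b * b * f 0)" for a b
    by (simp add: toeplitz_form_def numeral_2_eq_2)
  from assms(1)[of "(!) [1, 1]"] assms(1)[of "(!) [1, \<i>]"] assms(2)
  have "Im (f (- x)) + Im (f x) = 0" "Re (f (-x)) - Re (f x) = 0"
    unfolding two by (auto simp: complex_nonneg_Reals_iff complex_is_Real_iff)
  then show ?thesis by (simp add: complex_eq_iff)
qed

lemma toeplitz_form_eq_sesquilinear_form: "toeplitz_form f n x c = sesquilinear_form (\<lambda>i j. f (x i - x j)) n c c"
  by (simp add: toeplitz_form_def sesquilinear_form_def sum_distrib_left algebra_simps)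

lemma nonneg_RealsI: "Re z \<ge> 0 \<Longrightarrow> cnj z = z \<Longrightarrow> z \<in> \<real>\<^sub>\<ge>\<^sub>0"
  by (simp add: complex_nonneg_Reals_iff complex_eq_iff)

lemma positive_definite_fun_imp_toeplitz_form_nonneg_distinct:
  assumes pd: "positive_definite_fun f" and inj: "inj_on x {..<n}"
  shows "toeplitz_form f n x c \<in> \<real>\<^sub>\<ge>\<^sub>0"
proof -
  define A where "A = mat n n (\<lambda>(i, j). f (x i - x j))"
  let ?xs = "map x [0..<n]"
  have "distinct ?xs" using inj by (simp add: distinct_map lessThan_atLeast0)
  then have "positive_semidefinite_mat (mat n n (\<lambda>(i, j). f (?xs ! i - ?xs ! j)))"
    using pd unfolding positive_definite_fun_def by (auto dest: spec[of _ ?xs])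
  moreover have "mat n n (\<lambda>(i, j). f (?xs ! i - ?xs ! j)) = A"
    unfolding A_def by (rule eq_matI) auto
  ultimately have A: "positive_semidefinite_mat A" by simp
  have cA: "A \<in> carrier_mat n n" by (simp add: A_def)
  have herm: "f (x j - x i) = cnj (f (x i - x j))" if "i < n" "j < n" for i j
  proof -
    have "A $$ (j, i) = cnj (A $$ (i, j))"
      using A that unfolding positive_semidefinite_mat_def mat_adjoint_eq_self_iff[OF cA] by blast
    then show ?thesis using that by (simp add: A_def)
  qed
  have "0 \<le> Re (sesquilinear_form (\<lambda>i j. f (x i - x j)) n c c)"
  proof (rule hermitian_form_nonneg[OF herm])
    fix v l assume v: "\<exists>i<n. v i \<noteq> 0" "\<forall>i<n. (\<Sum>j<n. f (x i - x j) * v j) = complex_of_real l * v i"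
    have "eigenvalue A (complex_of_real l)"
      unfolding eigenvalue_iff_sum[OF cA] using v by (auto simp: A_def)
    then show "0 \<le> l" using A by (auto simp: positive_semidefinite_mat_def)
  qed
  then show ?thesis
    unfolding toeplitz_form_eq_sesquilinear_form
    by (rule nonneg_RealsI) (rule sesquilinear_form_hermitian[of n, symmetric], rule herm)
qed

text \<open>All later arguments use the right-hand side, which allows repeated points and speaks of
  no eigenvalues. Repetitions are removed by adding the coefficients of equal points. Conversely, at
  an eigenvector the form equals the eigenvalue times a positive number, which forces the eigenvalue
  to be real and nonnegative.\<close>

lemma positive_definite_fun_iff:
  "positive_definite_fun f \<longleftrightarrow> (\<forall>n x c. toeplitz_form f n x c \<in> \<real>\<^sub>\<ge>\<^sub>0)"
proof
  assume pd: "positive_definite_fun f"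
  show "\<forall>n x c. toeplitz_form f n x c \<in> \<real>\<^sub>\<ge>\<^sub>0"
  proof (intro allI)
    fix n :: nat and x :: "nat \<Rightarrow> real" and c :: "nat \<Rightarrow> complex"
    define S where "S = x ` {..<n}"
    define m where "m = card S"
    have "\<exists>y. bij_betw y {..<m} S"
      unfolding m_def lessThan_atLeast0 by (rule ex_bij_betw_nat_finite) (simp add: S_def)
    then obtain y where y: "bij_betw y {..<m} S" ..
    \<comment> \<open>The merged coefficient at the point \<open>u\<close>. The identity below is
      applied twice, to the column index and then to the row index.\<close>
    define d where "d u = (\<Sum>i | i < n \<and> x i = u. c i)" for u
    have *: "(\<Sum>i<n. g i * h (x i)) = (\<Sum>k<m. (\<Sum>i | i < n \<and> x i = y k. g i) * h (y k))"
      for g :: "nat \<Rightarrow> complex" and h :: "real \<Rightarrow> complex"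
    proof -
      have "(\<Sum>i<n. g i * h (x i)) = (\<Sum>u\<in>S. \<Sum>i | i \<in> {..<n} \<and> x i = u. g i * h (x i))"
        unfolding S_def by (rule sum.image_gen) auto
      also have "\<dots> = (\<Sum>u\<in>S. (\<Sum>i | i < n \<and> x i = u. g i) * h u)"
        unfolding sum_distrib_right by (intro sum.cong) auto
      also have "\<dots> = (\<Sum>k<m. (\<Sum>i | i < n \<and> x i = y k. g i) * h (y k))"
        by (rule sum.reindex_bij_betw[OF y, symmetric])
      finally show ?thesis .
    qed
    have "toeplitz_form f n x c = (\<Sum>i<n. cnj (c i) * (\<Sum>j<n. c j * f (x i - x j)))"
      by (simp add: toeplitz_form_def sum_distrib_left mult.assoc)
    also have "\<dots> = (\<Sum>i<n. cnj (c i) * (\<Sum>k<m. d (y k) * f (x i - y k)))"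
      using *[of c "\<lambda>u. f (_ - u)"] by (simp add: d_def)
    also have "\<dots> = (\<Sum>l<m. (\<Sum>i | i < n \<and> x i = y l. cnj (c i)) * (\<Sum>k<m. d (y k) * f (y l - y k)))"
      by (rule *)
    also have "\<dots> = toeplitz_form f m y (\<lambda>k. d (y k))"
      unfolding toeplitz_form_def by (rule sum.cong[OF refl], subst sum_distrib_left, simp add: d_def mult.assoc)
    also have "\<dots> \<in> \<real>\<^sub>\<ge>\<^sub>0"
      by (rule positive_definite_fun_imp_toeplitz_form_nonneg_distinct[OF pd]) (use y bij_betw_def in blast)
    finally show "toeplitz_form f n x c \<in> \<real>\<^sub>\<ge>\<^sub>0" .
  qed
next
  assume q: "\<forall>n x c. toeplitz_form f n x c \<in> \<real>\<^sub>\<ge>\<^sub>0"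
  have "f 0 \<in> \<real>\<^sub>\<ge>\<^sub>0" using q[rule_format, of "Suc 0" "\<lambda>_. 0" "\<lambda>_. 1"] by (simp add: toeplitz_form_def)
  then have "f 0 \<in> \<real>" by (simp add: complex_nonneg_Reals_iff complex_is_Real_iff)
  then have herm: "f (- x) = cnj (f x)" for x using toeplitz_form_nonneg_imp_hermitian q by blast
  show "positive_definite_fun f"
    unfolding positive_definite_fun_def positive_semidefinite_mat_def
  proof (intro allI impI conjI)
    fix xs :: "real list"
    define n where "n = length xs"
    let ?A = "mat (length xs) (length xs) (\<lambda>(i, j). f (xs ! i - xs ! j))"
    have cA: "?A \<in> carrier_mat n n" by (simp add: n_def)
    show "square_mat ?A" by simp
    show "mat_adjoint ?A = ?A"
      unfolding mat_adjoint_eq_self_iff[OF cA] by (auto simp: n_def herm[symmetric])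
    fix k assume "eigenvalue ?A k"
    then obtain v where v: "\<exists>i<n. v i \<noteq> 0" "\<And>i. i < n \<Longrightarrow> (\<Sum>j<n. ?A $$ (i, j) * v j) = k * v i"
      unfolding eigenvalue_iff_sum[OF cA] by blast
    define s where "s = (\<Sum>i<n. (cmod (v i))\<^sup>2)"
    have s: "s > 0"
    proof -
      obtain i where "i < n" "v i \<noteq> 0" using v(1) by blast
      then show ?thesis unfolding s_def by (intro sum_pos2[of _ i]) auto
    qed
    have "toeplitz_form f n ((!) xs) v = (\<Sum>i<n. cnj (v i) * (k * v i))"
      unfolding toeplitz_form_eq_sesquilinear_form sesquilinear_form_def
      by (intro sum.cong refl) (use v(2) in \<open>simp add: n_def\<close>)
    also have "\<dots> = k * complex_of_real s"
      by (simp add: s_def sum_distrib_left complex_norm_square algebra_simps del: of_real_power)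
    finally have "k * complex_of_real s \<in> \<real>\<^sub>\<ge>\<^sub>0" using q by metis
    then show "k \<in> \<real>\<^sub>\<ge>\<^sub>0" using s by (auto simp: complex_nonneg_Reals_iff zero_le_mult_iff)
  qed
qed

lemma positive_definite_fun_hermitian:
  assumes "positive_definite_fun f"
  shows "f (- x) = cnj (f x)"
proof -
  have q: "toeplitz_form f n x c \<in> \<real>\<^sub>\<ge>\<^sub>0" for n x c using assms positive_definite_fun_iff by blast
  from q[of "Suc 0" "\<lambda>_. 0" "\<lambda>_. 1"] have "f 0 \<in> \<real>"
    by (simp add: toeplitz_form_def complex_nonneg_Reals_iff complex_is_Real_iff)
  then show ?thesis using toeplitz_form_nonneg_imp_hermitian q by blast
qed

section \<open>Operations that preserve positive definiteness\<close>

lemma tendsto_toeplitz_form: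
  assumes "\<And>x. (\<lambda>k. g k x) \<longlonglongrightarrow> f x"
  shows "(\<lambda>k. toeplitz_form (g k) n x c) \<longlonglongrightarrow> toeplitz_form f n x c"
  unfolding toeplitz_form_def by (intro tendsto_intros assms)

lemma positive_definite_fun_limit:
  assumes "\<And>k. positive_definite_fun (g k)" and "\<And>x. (\<lambda>k. g k x) \<longlonglongrightarrow> f x"
  shows "positive_definite_fun f"
  unfolding positive_definite_fun_iff
proof (intro allI)
  fix n :: nat and x :: "nat \<Rightarrow> real" and c :: "nat \<Rightarrow> complex"
  have "\<forall>k. toeplitz_form (g k) n x c \<in> \<real>\<^sub>\<ge>\<^sub>0" using assms(1) positive_definite_fun_iff by blast
  then show "toeplitz_form f n x c \<in> \<real>\<^sub>\<ge>\<^sub>0"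
    by (intro closed_sequentially[OF closed_nonneg_Reals_complex _ tendsto_toeplitz_form[OF assms(2)]]) blast
qed

lemma positive_definite_fun_add:
  assumes "positive_definite_fun f" and "positive_definite_fun g"
  shows "positive_definite_fun (\<lambda>x. f x + g x)"
  unfolding positive_definite_fun_iff
proof (intro allI)
  fix n :: nat and x :: "nat \<Rightarrow> real" and c :: "nat \<Rightarrow> complex"
  have "toeplitz_form (\<lambda>x. f x + g x) n x c = toeplitz_form f n x c + toeplitz_form g n x c"
    by (simp add: toeplitz_form_def algebra_simps sum.distrib)
  then show "toeplitz_form (\<lambda>x. f x + g x) n x c \<in> \<real>\<^sub>\<ge>\<^sub>0"
    using assms by (simp add: positive_definite_fun_iff)
qed

lemma positive_definite_fun_zero: "positive_definite_fun (\<lambda>x. 0)"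
  by (simp add: positive_definite_fun_iff toeplitz_form_def)

lemma positive_definite_fun_one: "positive_definite_fun (\<lambda>x. 1)"
  unfolding positive_definite_fun_iff
proof (intro allI)
  fix n :: nat and x :: "nat \<Rightarrow> real" and c :: "nat \<Rightarrow> complex"
  have "toeplitz_form (\<lambda>x. 1) n x c = cnj (\<Sum>i<n. c i) * (\<Sum>i<n. c i)"
    by (simp add: toeplitz_form_def sum_product)
  also have "\<dots> = complex_of_real ((cmod (\<Sum>i<n. c i))\<^sup>2)"
    by (simp add: complex_norm_square mult.commute del: of_real_power cnj_sum)
  finally show "toeplitz_form (\<lambda>x. 1) n x c \<in> \<real>\<^sub>\<ge>\<^sub>0" by simp
qed

text \<open>A character factorises over the difference of two points, so it can be absorbed into the
  coefficients of the form. This special case replaces the general theorem on products of positive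
  definite functions.\<close>

lemma positive_definite_fun_mult_cis:
  assumes "positive_definite_fun g" and "0 \<le> w"
  shows "positive_definite_fun (\<lambda>x. g x * (complex_of_real w * cis (s * x)))"
  unfolding positive_definite_fun_iff
proof (intro allI)
  fix n :: nat and x :: "nat \<Rightarrow> real" and c :: "nat \<Rightarrow> complex"
  have cis: "cis (s * (x i - x j)) = cnj (cis (- s * x i)) * cis (- s * x j)" for i j
    by (simp add: cis_cnj cis_mult algebra_simps)
  have "toeplitz_form (\<lambda>x. g x * (complex_of_real w * cis (s * x))) n x c
    = complex_of_real w * toeplitz_form g n x (\<lambda>i. c i * cis (- s * x i))"
    unfolding toeplitz_form_def cis sum_distrib_left by (intro sum.cong refl) (simp add: algebra_simps)
  then show "toeplitz_form (\<lambda>x. g x * (complex_of_real w * cis (s * x))) n x c \<in> \<real>\<^sub>\<ge>\<^sub>0"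
    using assms by (simp add: positive_definite_fun_iff)
qed

text \<open>The power series of the exponential is a series of characters of frequencies m * s with
  coefficients w^m / m!, which are nonnegative. Keeping an arbitrary factor \<open>g\<close> lets
  exponentials of several terms be built up one at a time.\<close>

lemma positive_definite_fun_mult_exp_cis:
  assumes "positive_definite_fun g" and "0 \<le> w"
  shows "positive_definite_fun (\<lambda>x. g x * exp (complex_of_real w * cis (s * x)))"
proof (rule positive_definite_fun_limit)
  let ?p = "\<lambda>k x. \<Sum>m<k. g x * (complex_of_real (w ^ m / fact m) * cis ((real m * s) * x))"
  show "positive_definite_fun (?p k)" for k
  proof (induction k)
    case 0 show ?case by (simp add: positive_definite_fun_zero)
  next
    case (Suc k)
    show ?case unfolding sum.lessThan_Suc
      by (intro positive_definite_fun_add Suc positive_definite_fun_mult_cis assms) (use assms in auto)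
  qed
  show "(\<lambda>k. ?p k x) \<longlonglongrightarrow> g x * exp (complex_of_real w * cis (s * x))" for x
  proof -
    have "(\<lambda>m. (complex_of_real w * cis (s * x)) ^ m /\<^sub>R fact m) sums exp (complex_of_real w * cis (s * x))"
      by (rule exp_converges)
    then have "(\<lambda>m. g x * ((complex_of_real w * cis (s * x)) ^ m /\<^sub>R fact m)) sums
        (g x * exp (complex_of_real w * cis (s * x)))"
      by (rule sums_mult)
    moreover have "(complex_of_real w * cis (s * x)) ^ m /\<^sub>R fact m
        = complex_of_real (w ^ m / fact m) * cis ((real m * s) * x)" for m
      by (simp add: power_mult_distrib Complex.DeMoivre mult.assoc scaleR_conv_of_real divide_inverse mult.assoc)
    ultimately show ?thesis unfolding sums_def by simp
  qed
qed

lemma positive_definite_fun_exp_sum: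
  assumes "finite I" and "\<And>l. l \<in> I \<Longrightarrow> 0 \<le> w l"
  shows "positive_definite_fun
    (\<lambda>x. exp (\<Sum>l\<in>I. complex_of_real (w l) * exp (\<i> * of_real (s l) * of_real x)))"
  using assms
proof (induction I)
  case empty
  show ?case by (simp add: positive_definite_fun_one)
next
  case (insert l I)
  have "positive_definite_fun (\<lambda>x. exp (\<Sum>l\<in>I. complex_of_real (w l) * exp (\<i> * of_real (s l) * of_real x))
      * exp (complex_of_real (w l) * cis (s l * x)))"
    by (rule positive_definite_fun_mult_exp_cis) (use insert in auto)
  then show ?case
    using insert(1,2) by (simp add: exp_add cis_conv_exp mult.commute mult.left_commute)
qed

lemma positive_definite_fun_reflect:
  assumes "positive_definite_fun f"
  shows "positive_definite_fun (\<lambda>x. f (- x))"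
  unfolding positive_definite_fun_iff
proof (intro allI)
  fix n :: nat and x :: "nat \<Rightarrow> real" and c :: "nat \<Rightarrow> complex"
  have "toeplitz_form (\<lambda>x. f (- x)) n x c = toeplitz_form f n (\<lambda>i. - x i) c" by (simp add: toeplitz_form_def)
  then show "toeplitz_form (\<lambda>x. f (- x)) n x c \<in> \<real>\<^sub>\<ge>\<^sub>0" using assms by (simp add: positive_definite_fun_iff)
qed

section \<open>Conditionally positive definite functions\<close>

text \<open>The constraint on the coefficients makes additive constants invisible, even imaginary
  ones. Hermitian symmetry therefore does not follow and is carried along as a separate
  hypothesis.\<close>

definition cond_positive_definite :: "(real \<Rightarrow> complex) \<Rightarrow> bool" where
  "cond_positive_definite f \<longleftrightarrow> (\<forall>n x c. (\<Sum>i<n. c i) = 0 \<longrightarrow> toeplitz_form f n x c \<in> \<real>\<^sub>\<ge>\<^sub>0)"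

lemma exp_difference_quotient:
  "(\<lambda>k. complex_of_real (real (Suc k)) * (exp (complex_of_real (inverse (real (Suc k))) * z) - 1)) \<longlonglongrightarrow> z"
proof -
  have "((\<lambda>h. exp (h * z)) has_field_derivative z) (at 0)"
    by (auto intro!: derivative_eq_intros)
  then have "((\<lambda>h. (exp (h * z) - 1) / h) \<longlongrightarrow> z) (at 0)"
    by (simp add: DERIV_def)
  moreover have "filterlim (\<lambda>k. complex_of_real (inverse (real (Suc k)))) (at 0) sequentially"
  proof (rule filterlim_atI)
    have "(\<lambda>k. complex_of_real (inverse (real (Suc k)))) \<longlonglongrightarrow> of_real 0"
      by (intro tendsto_of_real LIMSEQ_inverse_real_of_nat)
    then show "(\<lambda>k. complex_of_real (inverse (real (Suc k)))) \<longlonglongrightarrow> 0" by simp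
    show "\<forall>\<^sub>F k in sequentially. complex_of_real (inverse (real (Suc k))) \<noteq> 0"
      by (simp del: of_nat_Suc)
  qed
  ultimately have "(\<lambda>k. (exp (complex_of_real (inverse (real (Suc k))) * z) - 1)
      / complex_of_real (inverse (real (Suc k)))) \<longlonglongrightarrow> z"
    by (rule filterlim_compose)
  then show ?thesis by (simp add: divide_inverse mult.commute del: of_nat_Suc)
qed

text \<open>In the difference quotient the subtracted constant 1 contributes only the squared
  modulus of the sum of the coefficients, which is zero under the constraint. Only the exponents 1 /
  (k + 1) are used.\<close>

lemma cond_positive_definite_log:
  assumes "\<And>r. 0 < r \<Longrightarrow> positive_definite_fun (branch_power L r)"
  shows "cond_positive_definite L" and "L (- x) = cnj (L x)"
proof -
  define g where "g k x = complex_of_real (real (Suc k)) *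
    (exp (complex_of_real (inverse (real (Suc k))) * L x) - 1)" for k x
  have g: "(\<lambda>k. g k x) \<longlonglongrightarrow> L x" for x
    unfolding g_def by (rule exp_difference_quotient)
  have g_eq: "g k x = complex_of_real (real (Suc k)) * (branch_power L (inverse (real (Suc k))) x - 1)" for k x
    by (simp add: g_def branch_power_def)
  have pd: "positive_definite_fun (branch_power L (inverse (real (Suc k))))" for k
    by (rule assms) simp
  show "cond_positive_definite L"
    unfolding cond_positive_definite_def
  proof (intro allI impI)
    fix n :: nat and x :: "nat \<Rightarrow> real" and c :: "nat \<Rightarrow> complex" assume c: "(\<Sum>i<n. c i) = (0 :: complex)"
    have "toeplitz_form (g k) n x c \<in> \<real>\<^sub>\<ge>\<^sub>0" for k
    proof -
      have "toeplitz_form (g k) n x c = complex_of_real (real (Suc k)) *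
          (toeplitz_form (branch_power L (inverse (real (Suc k)))) n x c - cnj (\<Sum>i<n. c i) * (\<Sum>i<n. c i))"
        by (simp add: toeplitz_form_def g_eq sum_product sum_distrib_left sum_subtractf[symmetric] algebra_simps del: of_nat_Suc)
      moreover have "toeplitz_form (branch_power L (inverse (real (Suc k)))) n x c \<in> \<real>\<^sub>\<ge>\<^sub>0"
        using pd positive_definite_fun_iff by blast
      ultimately show ?thesis by (simp add: c del: of_nat_Suc)
    qed
    then show "toeplitz_form L n x c \<in> \<real>\<^sub>\<ge>\<^sub>0"
      by (intro closed_sequentially[OF closed_nonneg_Reals_complex _ tendsto_toeplitz_form[OF g]]) blast
  qed
  have "g k (- x) = cnj (g k x)" for k
    using positive_definite_fun_hermitian[OF pd, of k x] by (simp add: g_eq)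
  then have "(\<lambda>k. cnj (g k x)) \<longlonglongrightarrow> L (- x)" using g[of "- x"] by simp
  moreover have "(\<lambda>k. cnj (g k x)) \<longlonglongrightarrow> cnj (L x)" by (intro tendsto_intros g)
  ultimately show "L (- x) = cnj (L x)" by (rule LIMSEQ_unique)
qed

lemma cond_positive_definite_quasi_additive:
  assumes cpd: "cond_positive_definite L" and herm: "\<And>x. L (- x) = cnj (L x)"
    and K: "\<And>x. \<bar>Re (L x)\<bar> \<le> K"
  shows "\<bar>Im (L (x + y)) - Im (L x) - Im (L y)\<bar> \<le> 4 * K"
proof -
  have *: "0 \<le> 4 * Re (L 0) - 2 * Re (L x) - 2 * Re (L y) + 2 * \<sigma> * (Im (L x) - Im (L y) - Im (L (x - y)))"
    if "\<sigma>\<^sup>2 = 1" for \<sigma> x y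
  proof -
    \<comment> \<open>The coefficients 1 at \<open>x\<close> and \<sigma> * \<i> at \<open>y\<close>
      turn the cross term into an imaginary part. The coefficient at 0 is chosen to make the sum
      vanish.\<close>
    let ?c = "(!) [Complex (-1) (- \<sigma>), 1, Complex 0 \<sigma>]"
    let ?x = "(!) [0, x, y]"
    have "(\<Sum>i<3. ?c i) = 0" by (simp add: numeral_3_eq_3 complex_eq_iff)
    then have q: "toeplitz_form L 3 ?x ?c \<in> \<real>\<^sub>\<ge>\<^sub>0" using cpd unfolding cond_positive_definite_def by blast
    have h: "L (y - x) = cnj (L (x - y))" using herm[of "x - y"] by simp
    have 0: "Im (L 0) = 0" using herm[of 0] by (simp add: complex_eq_iff)
    have "toeplitz_form L 3 ?x ?c = (\<Sum>i\<in>{0,1,2}. \<Sum>j\<in>{0,1,2}. cnj (?c i) * ?c j * L (?x i - ?x j))"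
      unfolding toeplitz_form_def by (simp add: numeral_3_eq_3 numeral_2_eq_2)
    then have "Re (toeplitz_form L 3 ?x ?c) = (1 + \<sigma>\<^sup>2) * Re (L 0) + (1 + \<sigma>\<^sup>2) * Re (L 0)
        - 2 * Re (L x) - 2 * \<sigma>\<^sup>2 * Re (L y) + 2 * \<sigma> * (Im (L x) - Im (L y) - Im (L (x - y)))"
      by (simp add: herm h 0 power2_eq_square algebra_simps)
    with q show ?thesis by (simp add: that complex_nonneg_Reals_iff)
  qed
  \<comment> \<open>The form yields the difference of two arguments, and \<open>- y\<close> turns it
    into a sum. The real parts contribute at most 8 * K against a factor 2, and the two signs of
    \<sigma> give the two inequalities.\<close>
  have "Im (L (- y)) = - Im (L y)" by (simp add: herm)
  with *[of 1 x "- y"] *[of "-1" x "- y"] K[of 0] K[of x] K[of "- y"] show ?thesis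
    by (simp add: abs_le_iff)
qed

text \<open>Homogenisation of a quasimorphism, as in Hyers' theorem: the slope is the limit of
  \<theta>(n) / n, and the rate of convergence D / n leaves an error of at most D at every natural
  number. Compactness of the unit interval fills the gaps, and oddness covers the negative half
  line.\<close>

lemma quasi_additive_near_linear:
  fixes \<theta> :: "real \<Rightarrow> real"
  assumes cont: "continuous_on UNIV \<theta>" and odd: "\<And>x. \<theta> (- x) = - \<theta> x"
    and D: "\<And>x y. \<bar>\<theta> (x + y) - \<theta> x - \<theta> y\<bar> \<le> D"
  obtains \<beta> B where "\<And>x. \<bar>\<theta> x - \<beta> * x\<bar> \<le> B"
proof -
  have D0: "0 \<le> D" using D[of 0 0] by linarith
  have mult: "\<bar>\<theta> (real m * x) - real m * \<theta> x\<bar> \<le> real m * D" for m x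
  proof (induction m)
    case 0 then show ?case using odd[of 0] by simp
  next
    case (Suc m)
    then show ?case using D[of "real m * x" x] by (simp add: algebra_simps abs_le_iff)
  qed
  define a where "a n = \<theta> (real (Suc n)) / real (Suc n)" for n
  have a_diff: "\<bar>a n - a m\<bar> \<le> D / real (Suc n) + D / real (Suc m)" for n m
  proof -
    let ?n = "real (Suc n)" and ?m = "real (Suc m)"
    \<comment> \<open>The value at the product is computed in two ways, as a multiple of each
      factor.\<close>
    have "\<bar>\<theta> (?m * ?n) - ?m * \<theta> ?n\<bar> \<le> ?m * D" "\<bar>\<theta> (?n * ?m) - ?n * \<theta> ?m\<bar> \<le> ?n * D"
      by (rule mult)+
    then have "\<bar>?m * \<theta> ?n - ?n * \<theta> ?m\<bar> \<le> ?m * D + ?n * D"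
      by (simp add: mult.commute abs_le_iff)
    then have "\<bar>?m * \<theta> ?n - ?n * \<theta> ?m\<bar> / (?n * ?m) \<le> (?m * D + ?n * D) / (?n * ?m)"
      by (intro divide_right_mono) auto
    moreover have "a n - a m = (?m * \<theta> ?n - ?n * \<theta> ?m) / (?n * ?m)"
      by (simp add: a_def divide_simps del: of_nat_Suc)
    moreover have "(?m * D + ?n * D) / (?n * ?m) = D / ?n + D / ?m"
      by (simp add: add_divide_distrib del: of_nat_Suc)
    ultimately show ?thesis by (simp add: abs_divide abs_mult del: of_nat_Suc)
  qed
  have lim0: "(\<lambda>k. D / real (Suc k)) \<longlonglongrightarrow> 0"
    using tendsto_mult_left[OF LIMSEQ_inverse_real_of_nat, of D] by (simp add: divide_inverse)
  have "Cauchy a"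
  proof (rule metric_CauchyI)
    fix e :: real assume "0 < e"
    then have "\<forall>\<^sub>F k in sequentially. D / real (Suc k) < e / 2"
      by (intro order_tendstoD(2)[OF lim0]) simp
    then obtain N where N: "\<And>k. k \<ge> N \<Longrightarrow> D / real (Suc k) < e / 2"
      by (auto simp: eventually_sequentially)
    have "dist (a m) (a n) < e" if "m \<ge> N" "n \<ge> N" for m n
      using a_diff[of m n] N[OF that(1)] N[OF that(2)] unfolding dist_real_def by linarith
    then show "\<exists>N. \<forall>m\<ge>N. \<forall>n\<ge>N. dist (a m) (a n) < e" by blast
  qed
  then obtain \<beta> where \<beta>: "a \<longlonglongrightarrow> \<beta>" using Cauchy_convergent convergent_def by blast
  have a_beta: "\<bar>a n - \<beta>\<bar> \<le> D / real (Suc n)" for n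
  proof (rule LIMSEQ_le)
    show "(\<lambda>m. \<bar>a n - a m\<bar>) \<longlonglongrightarrow> \<bar>a n - \<beta>\<bar>" by (intro tendsto_intros \<beta>)
    show "(\<lambda>m. D / real (Suc n) + D / real (Suc m)) \<longlonglongrightarrow> D / real (Suc n)"
      using tendsto_add[OF tendsto_const lim0, of "D / real (Suc n)"] by simp
  qed (use a_diff in blast)
  define g where "g x = \<theta> x - \<beta> * x" for x
  have g_nat: "\<bar>g (real n)\<bar> \<le> D" for n
  proof (cases n)
    case 0 then show ?thesis using odd[of 0] D0 by (simp add: g_def)
  next
    case (Suc m)
    have "g (real n) = (a m - \<beta>) * real (Suc m)"
      unfolding Suc g_def a_def by (simp add: field_simps del: of_nat_Suc)
    then have "\<bar>g (real n)\<bar> = \<bar>a m - \<beta>\<bar> * real (Suc m)" by (simp add: abs_mult)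
    also have "\<dots> \<le> D / real (Suc m) * real (Suc m)" using a_beta by (intro mult_right_mono) auto
    finally show ?thesis by (simp del: of_nat_Suc)
  qed
  have "continuous_on {0..1} g" unfolding g_def
    by (intro continuous_intros continuous_on_subset[OF cont]) auto
  then have "compact (g ` {0..1})" by (intro compact_continuous_image) auto
  then obtain C where C: "\<And>x. x \<in> {0..1} \<Longrightarrow> \<bar>g x\<bar> \<le> C"
    using compact_imp_bounded bounded_iff by (metis imageI real_norm_def)
  have pos: "\<bar>g x\<bar> \<le> 2 * D + C" if "0 \<le> x" for x
  proof -
    define n where "n = nat \<lfloor>x\<rfloor>"
    have x: "x - real n \<in> {0..1}" using that unfolding n_def atLeastAtMost_iff by linarith
    \<comment> \<open>The final bound collects D for this splitting, D for the integer part and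
      \<open>C\<close> for the fractional part.\<close>
    have "\<bar>\<theta> (real n + (x - real n)) - \<theta> (real n) - \<theta> (x - real n)\<bar> \<le> D" by (rule D)
    then show ?thesis using g_nat[of n] C[OF x] by (simp add: g_def algebra_simps abs_le_iff)
  qed
  have "\<bar>g x\<bar> \<le> 2 * D + C" for x
    using pos[of x] pos[of "- x"] odd[of x] by (cases "0 \<le> x") (auto simp: g_def abs_le_iff)
  then show ?thesis using that unfolding g_def by blast
qed

text \<open>The form of a linear function separates into two products, each containing the sum of
  the coefficients or its conjugate, so it vanishes under the constraint.\<close>

lemma cond_positive_definite_minus_drift:
  assumes "cond_positive_definite L"
  shows "cond_positive_definite (\<lambda>x. L x - \<i> * of_real (\<beta> * x))"
  unfolding cond_positive_definite_def
proof (intro allI impI)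
  fix n :: nat and x :: "nat \<Rightarrow> real" and c :: "nat \<Rightarrow> complex" assume c: "(\<Sum>i<n. c i) = (0 :: complex)"
  have "toeplitz_form (\<lambda>x. L x - \<i> * of_real (\<beta> * x)) n x c = toeplitz_form L n x c
      - \<i> * of_real \<beta> * ((\<Sum>i<n. cnj (c i) * of_real (x i)) * (\<Sum>i<n. c i) -
        cnj (\<Sum>i<n. c i) * (\<Sum>i<n. c i * of_real (x i)))"
  proof -
    have "(\<Sum>i<n. cnj (c i) * of_real (x i)) * (\<Sum>i<n. c i)
        = (\<Sum>i<n. \<Sum>j<n. cnj (c i) * of_real (x i) * c j)"
      "cnj (\<Sum>i<n. c i) * (\<Sum>i<n. c i * of_real (x i))
        = (\<Sum>i<n. \<Sum>j<n. cnj (c i) * (c j * of_real (x j)))"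
      by (simp_all only: cnj_sum sum_product)
    then show ?thesis
      by (simp add: toeplitz_form_def sum_distrib_left sum_subtractf[symmetric] algebra_simps del: cnj_sum)
  qed
  then show "toeplitz_form (\<lambda>x. L x - \<i> * of_real (\<beta> * x)) n x c \<in> \<real>\<^sub>\<ge>\<^sub>0"
    using assms c by (simp add: cond_positive_definite_def)
qed

section \<open>Fejer means over cyclic groups\<close>

lemma cis_int_div_eq_1_iff:
  assumes "0 < M"
  shows "cis (2 * pi * of_int b / real M) = 1 \<longleftrightarrow> int M dvd b"
proof
  assume "cis (2 * pi * of_int b / real M) = 1"
  then obtain n :: int where "2 * pi * of_int b / real M = of_int (2 * n) * pi"
    by (auto simp: cis_conv_exp exp_eq_1)
  then have "of_int b = real_of_int (n * int M)" using assms by (simp add: field_simps)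
  then have "b = n * int M" by (simp only: of_int_eq_iff)
  then show "int M dvd b" by simp
next
  assume "int M dvd b"
  then obtain n where "b = int M * n" by blast
  then have "2 * pi * of_int b / real M = 2 * pi * of_int n" using assms by simp
  then show "cis (2 * pi * of_int b / real M) = 1" by simp
qed

lemma sum_roots_of_unity:
  assumes "0 < M"
  shows "(\<Sum>n<M. cis (2 * pi * of_int (b * int n) / real M)) = (if int M dvd b then of_nat M else 0)"
proof -
  define q where "q = cis (2 * pi * of_int b / real M)"
  have qn: "cis (2 * pi * of_int (b * int n) / real M) = q ^ n" for n
    by (simp add: q_def Complex.DeMoivre mult.commute mult.left_commute)
  have qM: "q ^ M = 1" unfolding qn[symmetric] by (subst cis_int_div_eq_1_iff[OF assms]) simp
  show ?thesis
  proof (cases "int M dvd b")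
    case True
    then have "q = 1" by (simp add: q_def cis_int_div_eq_1_iff[OF assms])
    then show ?thesis using True unfolding qn by simp
  next
    case False
    then have "q \<noteq> 1" by (simp add: q_def cis_int_div_eq_1_iff[OF assms])
    then show ?thesis using False unfolding qn by (simp add: geometric_sum qM)
  qed
qed

text \<open>Representatives symmetric about 0 give each frequency a sign; the odd order leaves no
  frequency with an ambiguous one. Shifting the index range multiplies the sum by a root of unity,
  which is 1 whenever the sum is not zero.\<close>

lemma sum_roots_of_unity_symmetric:
  "(\<Sum>l\<in>{- int p..int p}. cis (2 * pi * of_int (l * b) / real (2 * p + 1)))
    = (if int (2 * p + 1) dvd b then of_nat (2 * p + 1) else 0)"
proof -
  let ?M = "2 * p + 1"
  have "(\<Sum>l\<in>{- int p..int p}. cis (2 * pi * of_int (l * b) / real ?M))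
      = (\<Sum>n<?M. cis (2 * pi * of_int ((int n - int p) * b) / real ?M))"
    by (rule sum.reindex_bij_witness[of _ "\<lambda>n. int n - int p" "\<lambda>l. nat (l + int p)"]) auto
  also have "\<dots> = (\<Sum>n<?M. cis (2 * pi * of_int (b * int n) / real ?M) * cis (- 2 * pi * of_int (b * int p) / real ?M))"
    by (intro sum.cong refl) (simp add: cis_mult diff_divide_distrib add_divide_distrib algebra_simps)
  also have "\<dots> = (if int ?M dvd b then of_nat ?M else 0) * cis (- 2 * pi * of_int (b * int p) / real ?M)"
    unfolding sum_distrib_right[symmetric] by (subst sum_roots_of_unity) simp_all
  also have "\<dots> = (if int ?M dvd b then of_nat ?M else 0)"
  proof (cases "int ?M dvd b")
    case True
    then have "int ?M dvd - (b * int p)" by simp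
    then have "cis (2 * pi * of_int (- (b * int p)) / real ?M) = 1"
      by (subst cis_int_div_eq_1_iff) auto
    then show ?thesis using True by simp
  qed simp
  finally show ?thesis .
qed

lemma dvd_diff_add_iff_eq_mod:
  assumes "i < M"
  shows "int M dvd int j - int i + int a \<longleftrightarrow> i = (j + a) mod M"
proof -
  have "int M dvd int j - int i + int a \<longleftrightarrow> int i mod int M = int (j + a) mod int M"
    by (subst mod_eq_dvd_iff) (simp add: dvd_diff_commute algebra_simps)
  also have "\<dots> \<longleftrightarrow> i mod M = (j + a) mod M"
    by (simp only: zmod_int[symmetric] of_nat_eq_iff)
  finally show ?thesis using assms by simp
qed

text \<open>The weights are Fejer means of \<open>\<psi>\<close> over the group of order \<open>2 * p + 1\<close>. At a nonzero
  frequency the coefficients of the quadratic form sum to zero, so conditional positivity suffices.\<close>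

lemma cyclic_Fejer_weights:
  assumes cpd: "cond_positive_definite \<psi>" and herm: "\<And>x. \<psi> (- x) = cnj (\<psi> x)"
    and B: "\<And>x. cmod (\<psi> x) \<le> B"
  obtains w :: "int \<Rightarrow> real" where
    "\<And>l. l \<in> {- int p..int p} \<Longrightarrow> l \<noteq> 0 \<Longrightarrow> 0 \<le> w l" and "\<bar>w 0\<bar> \<le> B" and
    "\<And>a. a \<le> 2 * p + 1 \<Longrightarrow> cmod ((\<Sum>l\<in>{- int p..int p}. complex_of_real (w l) *
        cis (2 * pi * of_int (l * int a) / real (2 * p + 1))) - \<psi> (real a * \<delta>))
      \<le> 2 * B * real a / real (2 * p + 1)"
proof -
  define M where "M = 2 * p + 1"
  have M: "0 < M" by (simp add: M_def)
  have B0: "0 \<le> B" using B[of 0] norm_ge_zero order_trans by blast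
  define c where "c l k = cis (2 * pi * of_int (l * int k) / real M)" for l k
  define Q where "Q l = toeplitz_form \<psi> M (\<lambda>k. real k * \<delta>) (c l)" for l
  \<comment> \<open>Grouping the terms of \<open>Q l\<close> by m = i - j produces the triangular
    factor M - |m| of the Fejer kernel. Division by M^2 combines its normalisation M with the M of
    Fourier inversion.\<close>
  define w where "w l = Re (Q l) / (real M)\<^sup>2" for l
  have cc: "cnj (c l i) * c l j * c l a = cis (2 * pi * of_int (l * (int j - int i + int a)) / real M)" for l i j a
    by (simp add: c_def cis_cnj cis_mult add_divide_distrib[symmetric] diff_divide_distrib[symmetric] algebra_simps)
  have h: "\<psi> (real j * \<delta> - real i * \<delta>) = cnj (\<psi> (real i * \<delta> - real j * \<delta>))" for i j
    using herm[of "real i * \<delta> - real j * \<delta>"] by simp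
  have "cnj (Q l) = Q l" for l
    unfolding Q_def toeplitz_form_eq_sesquilinear_form by (rule sesquilinear_form_hermitian[symmetric]) (rule h)
  then have "Im (Q l) = 0" for l by (metis Reals_cnj_iff complex_is_Real_iff)
  then have w_eq: "complex_of_real (w l) = Q l / (of_nat M)\<^sup>2" for l
    by (simp add: w_def complex_eq_iff Re_divide_of_nat Im_divide_of_nat flip: of_nat_power)
  show thesis
  proof (rule that[of w])
    fix l assume l: "l \<in> {- int p..int p}" "l \<noteq> 0"
    have "\<not> int M dvd l"
    proof
      assume "int M dvd l"
      then have "\<bar>int M\<bar> \<le> \<bar>l\<bar>" using l(2) by (rule dvd_imp_le_int[rotated])
      then show False using l(1) by (auto simp: M_def)
    qed
    then have "(\<Sum>k<M. c l k) = 0" unfolding c_def using sum_roots_of_unity[OF M, of l] by simp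
    then have "Q l \<in> \<real>\<^sub>\<ge>\<^sub>0" using cpd unfolding cond_positive_definite_def Q_def by blast
    then show "0 \<le> w l" by (simp add: w_def complex_nonneg_Reals_iff)
  next
    have "cmod (Q 0) \<le> (\<Sum>i<M. \<Sum>j<M. B)"
      unfolding Q_def toeplitz_form_def by (intro sum_norm_le) (simp add: c_def B)
    then have "\<bar>Re (Q 0)\<bar> \<le> B * (real M)\<^sup>2"
      using abs_Re_le_cmod[of "Q 0"] by (simp add: power2_eq_square mult.commute mult.left_commute)
    then show "\<bar>w 0\<bar> \<le> B" using M by (simp add: w_def abs_divide divide_le_eq)
  next
    fix a assume "a \<le> 2 * p + 1"
    then have a: "a \<le> M" by (simp add: M_def)
    let ?S = "\<Sum>l\<in>{- int p..int p}. complex_of_real (w l) * c l a"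
    \<comment> \<open>Fourier inversion: summing over \<open>l\<close> first keeps only the pairs
      with i = j + a modulo M, hence exactly one \<open>i\<close> for each \<open>j\<close>.\<close>
    have "(of_nat M)\<^sup>2 * ?S = (\<Sum>l\<in>{- int p..int p}. Q l * c l a)"
      using M by (simp add: w_eq sum_distrib_left)
    also have "\<dots> = (\<Sum>l\<in>{- int p..int p}. \<Sum>i<M. \<Sum>j<M. \<psi> (real i * \<delta> - real j * \<delta>) *
        cis (2 * pi * of_int (l * (int j - int i + int a)) / real M))"
      unfolding Q_def toeplitz_form_def sum_distrib_right cc[symmetric]
      by (intro sum.cong refl) (simp add: algebra_simps)
    also have "\<dots> = (\<Sum>i<M. \<Sum>j<M. \<Sum>l\<in>{- int p..int p}. \<psi> (real i * \<delta> - real j * \<delta>) *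
        cis (2 * pi * of_int (l * (int j - int i + int a)) / real M))"
      by (subst sum.swap, intro sum.cong refl, rule sum.swap)
    also have "\<dots> = (\<Sum>i<M. \<Sum>j<M. \<psi> (real i * \<delta> - real j * \<delta>) *
        (if int M dvd int j - int i + int a then of_nat M else 0))"
      by (simp only: sum_distrib_left[symmetric] M_def sum_roots_of_unity_symmetric)
    also have "\<dots> = (\<Sum>j<M. \<Sum>i<M. \<psi> (real i * \<delta> - real j * \<delta>) *
        (if int M dvd int j - int i + int a then of_nat M else 0))"
      by (rule sum.swap)
    also have "\<dots> = (\<Sum>j<M. \<Sum>i<M. if i = (j + a) mod M then of_nat M * \<psi> (real i * \<delta> - real j * \<delta>) else 0)"
      by (intro sum.cong refl) (simp add: dvd_diff_add_iff_eq_mod)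
    also have "\<dots> = (\<Sum>j<M. of_nat M * \<psi> (real ((j + a) mod M) * \<delta> - real j * \<delta>))"
      using M by simp
    finally have "of_nat M * (of_nat M * ?S) = of_nat M * (\<Sum>j<M. \<psi> (real ((j + a) mod M) * \<delta> - real j * \<delta>))"
      by (simp only: sum_distrib_left power2_eq_square mult.assoc)
    then have S: "of_nat M * ?S = (\<Sum>j<M. \<psi> (real ((j + a) mod M) * \<delta> - real j * \<delta>))"
      using M by simp
    have "of_nat M * (?S - \<psi> (real a * \<delta>))
        = (\<Sum>j<M. \<psi> (real ((j + a) mod M) * \<delta> - real j * \<delta>) - \<psi> (real a * \<delta>))"
      by (simp add: right_diff_distrib S sum_subtractf)
    \<comment> \<open>For j < M - a nothing wraps around and the summand is zero. Only
      \<open>a\<close> indices remain, each with an error of at most 2 * B.\<close>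
    also have "\<dots> = (\<Sum>j\<in>{M - a..<M}. \<psi> (real ((j + a) mod M) * \<delta> - real j * \<delta>) - \<psi> (real a * \<delta>))"
      by (rule sum.mono_neutral_right) (auto simp: algebra_simps)
    finally have "real M * cmod (?S - \<psi> (real a * \<delta>))
        = cmod (\<Sum>j\<in>{M - a..<M}. \<psi> (real ((j + a) mod M) * \<delta> - real j * \<delta>) - \<psi> (real a * \<delta>))"
      by (simp only: norm_mult[symmetric] norm_of_nat[symmetric, where 'a = complex])
    also have "\<dots> \<le> (\<Sum>j\<in>{M - a..<M}. B + B)"
      by (intro sum_norm_le order_trans[OF norm_triangle_ineq4] add_mono B)
    also have "\<dots> = 2 * B * real a" using a by simp
    finally show "cmod ((\<Sum>l\<in>{- int p..int p}. complex_of_real (w l) *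
        cis (2 * pi * of_int (l * int a) / real (2 * p + 1))) - \<psi> (real a * \<delta>))
      \<le> 2 * B * real a / real (2 * p + 1)"
      unfolding M_def[symmetric] c_def[symmetric] using M by (simp add: pos_le_divide_eq mult.commute)
  qed
qed

section \<open>Tightness of the weights\<close>

lemma sin_ge_half:
  assumes "0 \<le> x" "x \<le> pi / 2"
  shows "x / 2 \<le> sin (x::real)"
proof (cases "x = 0")
  case False
  let ?y = "x / 2"
  have y: "0 < ?y" "?y \<le> pi / 4" using assms False by auto
  have cos_ge: "sqrt 2 / 2 \<le> cos z" if "0 \<le> z" "z \<le> pi / 4" for z :: real
    using cos_monotone_0_pi_le[of z "pi / 4"] that by (simp add: cos_45)
  obtain z where z: "0 < z" "z < ?y" "sin ?y - sin 0 = (?y - 0) * cos z"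
    using MVT2[of 0 ?y sin cos] y(1) by (auto intro: DERIV_sin)
  \<comment> \<open>By the double angle formula and the mean value theorem, sin x is x times two
    cosines at arguments of at most pi / 4. Each cosine is at least sqrt 2 / 2, and the product of
    these bounds is 1 / 2.\<close>
  have "x / 2 = 2 * (?y * (sqrt 2 / 2)) * (sqrt 2 / 2)" by simp
  also have "\<dots> \<le> 2 * (?y * cos z) * cos ?y"
  proof -
    have c: "sqrt 2 / 2 \<le> cos z" "sqrt 2 / 2 \<le> cos ?y" by (rule cos_ge; use y z in linarith)+
    moreover have "0 \<le> sqrt 2 / (2 :: real)" by simp
    ultimately have "0 \<le> cos z" by linarith
    with c y show ?thesis by (intro mult_mono mult_left_mono) auto
  qed
  also have "\<dots> = sin (2 * ?y)" using z(3) by (simp only: sin_double) simp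
  finally show ?thesis by simp
qed simp

text \<open>The geometric sum is at most 2 / |q - 1|. Since |l| is below M / 2, the sine estimate
  gives |q - 1| at least pi * |l| / M. Replacing pi by 2 leaves M / |l|, which the hypothesis on
  \<open>n\<close> bounds by n / 2.\<close>

lemma average_cis_le_half:
  assumes M: "M = 2 * p + 1" and l: "l \<in> {- int p..int p}" and n: "2 * M \<le> nat \<bar>l\<bar> * n"
  shows "Re (\<Sum>j<n. cis (2 * pi * of_int (l * int j) / real M)) \<le> real n / 2"
proof -
  define q where "q = cis (2 * pi * of_int l / real M)"
  have l0: "l \<noteq> 0" using n M by auto
  have M0: "real M > 0" using M by simp
  have "cmod (q - 1) = 2 * \<bar>sin (pi * of_int l / real M)\<bar>"
    using dist_exp_i_1[of "2 * pi * of_int l / real M"] by (simp add: q_def cis_conv_exp)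
  also have "\<bar>sin (pi * of_int l / real M)\<bar> = \<bar>sin (pi * \<bar>of_int l\<bar> / real M)\<bar>"
    by (cases "l \<ge> 0") (auto simp: minus_mult_right[symmetric] minus_divide_left[symmetric])
  also have "2 * \<dots> \<ge> 2 * (pi * \<bar>of_int l\<bar> / real M / 2)"
  proof -
    have "2 * \<bar>real_of_int l\<bar> \<le> real M" using l by (auto simp: M)
    then have "pi * (2 * \<bar>real_of_int l\<bar>) \<le> pi * real M" by (intro mult_left_mono) auto
    then have "pi * \<bar>of_int l\<bar> / real M \<le> pi / 2"
      using M0 by (simp add: divide_simps)
    then have "pi * \<bar>of_int l\<bar> / real M / 2 \<le> sin (pi * \<bar>of_int l\<bar> / real M)"
      using M0 by (intro sin_ge_half) auto
    then show ?thesis by linarith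
  qed
  finally have ge: "pi * \<bar>of_int l\<bar> / real M \<le> cmod (q - 1)" by simp
  moreover have pos: "0 < pi * \<bar>real_of_int l\<bar> / real M" using l0 M0 by simp
  ultimately have q1: "q \<noteq> 1" by auto
  have qn: "cis (2 * pi * of_int (l * int n) / real M) = q ^ n" for n
    by (simp add: q_def Complex.DeMoivre mult.commute mult.left_commute)
  have "Re (\<Sum>j<n. cis (2 * pi * of_int (l * int j) / real M)) \<le> cmod (\<Sum>j<n. q ^ j)"
    unfolding qn by (rule complex_Re_le_cmod)
  also have "\<dots> = cmod (q ^ n - 1) / cmod (q - 1)"
    by (simp add: geometric_sum[OF q1] norm_divide)
  also have "\<dots> \<le> 2 / (pi * \<bar>of_int l\<bar> / real M)"
  proof (rule frac_le)
    show "cmod (q ^ n - 1) \<le> 2"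
      using norm_triangle_ineq4[of "q ^ n" 1] by (simp add: norm_power q_def)
  qed (use ge pos in auto)
  also have "\<dots> \<le> 2 / (2 * \<bar>of_int l\<bar> / real M)"
    using l0 M0 pi_ge_two by (intro divide_left_mono divide_right_mono mult_right_mono mult_pos_pos divide_pos_pos) auto
  also have "\<dots> = real M / \<bar>of_int l\<bar>" by simp
  also have "\<dots> \<le> real n / 2"
  proof -
    have "real (2 * M) \<le> real (nat \<bar>l\<bar> * n)" using n by (simp only: of_nat_le_iff)
    then show ?thesis using l0 by (simp add: divide_simps mult.commute)
  qed
  finally show ?thesis .
qed

text \<open>The mass at high frequencies is controlled by the modulus of continuity at the origin: averaging
  over \<open>n\<close> lattice points damps every frequency above \<open>2 * M / n\<close> by a factor of two.\<close>

lemma Fejer_weights_tail: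
  fixes w :: "int \<Rightarrow> real"
  assumes M: "M = 2 * p + 1"
    and w0: "\<And>l. l \<in> {- int p..int p} \<Longrightarrow> l \<noteq> 0 \<Longrightarrow> 0 \<le> w l"
    and approx: "\<And>a. a < n \<Longrightarrow> cmod ((\<Sum>l\<in>{- int p..int p}. complex_of_real (w l) *
        cis (2 * pi * of_int (l * int a) / real M)) - z) \<le> e"
    and n: "0 < n"
  shows "(\<Sum>l | l \<in> {- int p..int p} \<and> 2 * M \<le> nat \<bar>l\<bar> * n. w l) \<le> 4 * e"
proof -
  define S where "S a = (\<Sum>l\<in>{- int p..int p}. complex_of_real (w l) * cis (2 * pi * of_int (l * int a) / real M))" for a
  define C where "C l = Re (\<Sum>j<n. cis (2 * pi * of_int (l * int j) / real M))" for l
  have Cn: "C l \<le> real n" for l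
    unfolding C_def Re_sum using sum_bounded_above[of "{..<n}" "\<lambda>j. Re (cis (2 * pi * of_int (l * int j) / real M))" 1] by simp
  let ?T = "{l. l \<in> {- int p..int p} \<and> 2 * M \<le> nat \<bar>l\<bar> * n}"
  \<comment> \<open>The factor n - C l is nonnegative throughout and at least n / 2 on the tail, so
    the tail can be enlarged to all frequencies, where the sum is known.\<close>
  have "(\<Sum>l\<in>?T. w l) * (real n / 2) \<le> (\<Sum>l\<in>?T. w l * (real n - C l))"
    unfolding sum_distrib_right
  proof (rule sum_mono)
    fix l assume l: "l \<in> ?T"
    then have "C l \<le> real n / 2" unfolding C_def by (intro average_cis_le_half[OF M]) auto
    moreover have "0 \<le> w l" using l M by (intro w0) auto
    ultimately show "w l * (real n / 2) \<le> w l * (real n - C l)"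
      by (intro mult_left_mono) auto
  qed
  also have "\<dots> \<le> (\<Sum>l\<in>{- int p..int p}. w l * (real n - C l))"
  proof (rule sum_mono2)
    fix l assume l: "l \<in> {- int p..int p} - ?T"
    show "0 \<le> w l * (real n - C l)"
    proof (cases "l = 0")
      \<comment> \<open>At frequency zero the factor n - C l is zero, so a negative weight there
        does no harm.\<close>
      case True then show ?thesis by (simp add: C_def)
    next
      case False then show ?thesis using w0[of l] Cn[of l] l by (intro mult_nonneg_nonneg) auto
    qed
  qed auto
  also have "\<dots> = (\<Sum>j<n. Re (S 0 - S j))"
  proof -
    have "(\<Sum>j<n. Re (S 0 - S j)) = (\<Sum>j<n. \<Sum>l\<in>{- int p..int p}. w l * (1 - Re (cis (2 * pi * of_int (l * int j) / real M))))"
      by (simp add: S_def sum_subtractf right_diff_distrib del: cis.sel)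
    also have "\<dots> = (\<Sum>l\<in>{- int p..int p}. \<Sum>j<n. w l * (1 - Re (cis (2 * pi * of_int (l * int j) / real M))))"
      by (rule sum.swap)
    also have "\<dots> = (\<Sum>l\<in>{- int p..int p}. w l * (real n - C l))"
      by (simp add: C_def sum_distrib_left[symmetric] sum_subtractf del: cis.sel)
    finally show ?thesis by simp
  qed
  \<comment> \<open>All values \<open>S j\<close> lie within \<open>e\<close> of the common value
    \<open>z\<close>, including \<open>S 0\<close>.\<close>
  also have "\<dots> \<le> (\<Sum>j<n. 2 * e)"
  proof (rule sum_mono)
    fix j assume "j \<in> {..<n}"
    then have "cmod (S 0 - z) \<le> e" "cmod (S j - z) \<le> e"
      using approx n unfolding S_def by blast+
    moreover have "Re (S 0 - S j) \<le> cmod ((S 0 - z) - (S j - z))"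
      using complex_Re_le_cmod[of "S 0 - S j"] by simp
    moreover have "cmod ((S 0 - z) - (S j - z)) \<le> cmod (S 0 - z) + cmod (S j - z)"
      by (rule norm_triangle_ineq4)
    ultimately show "Re (S 0 - S j) \<le> 2 * e" by linarith
  qed
  finally have "(\<Sum>l\<in>?T. w l) * (real n / 2) \<le> (4 * e) * (real n / 2)" by (simp add: mult.commute)
  then show ?thesis using n by (simp only: mult_le_cancel_right)
qed

section \<open>Limits of exponential sums on the upper half plane\<close>

definition exp_sum :: "int set \<Rightarrow> (int \<Rightarrow> real) \<Rightarrow> (int \<Rightarrow> real) \<Rightarrow> complex \<Rightarrow> complex" where
  "exp_sum I w s z = (\<Sum>l\<in>I. complex_of_real (w l) * exp (\<i> * of_real (s l) * z))"

lemma norm_exp_upper: "0 \<le> s \<Longrightarrow> 0 \<le> Im z \<Longrightarrow> cmod (exp (\<i> * of_real s * z)) \<le> 1"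
  by (simp add: norm_exp_eq_Re)

lemma norm_exp_diff_upper:
  assumes "0 \<le> s" "0 \<le> Im z" "0 \<le> Im u"
  shows "cmod (exp (\<i> * of_real s * z) - exp (\<i> * of_real s * u)) \<le> s * cmod (z - u)"
proof (rule field_differentiable_bound[where S = "{z. 0 \<le> Im z}" and f' = "\<lambda>z. \<i> * of_real s * exp (\<i> * of_real s * z)"])
  show "convex {z. 0 \<le> Im z}" by (rule convex_halfspace_Im_ge)
  fix z assume "z \<in> {z. 0 \<le> Im z}"
  then show "cmod (\<i> * of_real s * exp (\<i> * of_real s * z)) \<le> s"
    using mult_left_mono[OF norm_exp_upper[OF assms(1), of z] assms(1)] assms(1) by (simp add: norm_mult)
  show "((\<lambda>z. exp (\<i> * of_real s * z)) has_field_derivative \<i> * of_real s * exp (\<i> * of_real s * z))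
      (at z within {z. 0 \<le> Im z})"
    by (auto intro!: derivative_eq_intros)
qed (use assms in auto)

lemma norm_exp_sum_le:
  assumes "\<And>l. l \<in> I \<Longrightarrow> 0 \<le> w l" "\<And>l. l \<in> I \<Longrightarrow> 0 \<le> s l" "0 \<le> Im z"
  shows "cmod (exp_sum I w s z) \<le> sum w I"
  unfolding exp_sum_def
proof (rule sum_norm_le)
  fix l assume "l \<in> I"
  then show "cmod (complex_of_real (w l) * exp (\<i> * of_real (s l) * z)) \<le> w l"
    using mult_left_mono[OF norm_exp_upper, of "s l" z "w l"] assms by (simp add: norm_mult)
qed

text \<open>Frequencies up to \<open>R\<close> give a Lipschitz bound by their size and the total
  mass. Those above \<open>R\<close> carry little weight, and each of their exponentials changes by
  at most 2, uniformly up to the real axis.\<close>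

lemma exp_sum_equicontinuous:
  assumes fin: "\<And>k. finite (I k)"
    and w: "\<And>k l. l \<in> I k \<Longrightarrow> 0 \<le> w k l" and s: "\<And>k l. l \<in> I k \<Longrightarrow> 0 \<le> s k l"
    and mass: "\<And>k. sum (w k) (I k) \<le> C"
    and tight: "\<And>e. 0 < e \<Longrightarrow> \<exists>R. \<forall>k. (\<Sum>l | l \<in> I k \<and> R < s k l. w k l) \<le> e"
    and e: "0 < e"
  obtains d where "0 < d" "\<And>k z u. 0 \<le> Im z \<Longrightarrow> 0 \<le> Im u \<Longrightarrow> cmod (z - u) < d \<Longrightarrow>
    cmod (exp_sum (I k) (w k) (s k) z - exp_sum (I k) (w k) (s k) u) < e"
proof -
  obtain R where R: "\<And>k. (\<Sum>l | l \<in> I k \<and> R < s k l. w k l) \<le> e / 8"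
    using tight[of "e / 8"] e by auto
  \<comment> \<open>Any index would do here; \<open>undefined\<close> merely names one.\<close>
  have C0: "0 \<le> C" using mass[of undefined] sum_nonneg[of "I undefined" "w undefined"] w by force
  \<comment> \<open>Low frequencies then contribute at most e / 4, as do the high ones. The added
    ones keep the denominator positive for zero mass or any sign of \<open>R\<close>.\<close>
  define d where "d = e / (4 * (C + 1) * (\<bar>R\<bar> + 1))"
  have d: "0 < d" using e C0 by (auto simp: d_def intro!: divide_pos_pos mult_pos_pos)
  show thesis
  proof (rule that[OF d])
    fix k z u assume z: "0 \<le> Im z" and u: "0 \<le> Im u" and zu: "cmod (z - u) < d"
    let ?d = "\<lambda>l. cmod (complex_of_real (w k l) * exp (\<i> * of_real (s k l) * z)
       - complex_of_real (w k l) * exp (\<i> * of_real (s k l) * u))"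
    have d_eq: "?d l = w k l * cmod (exp (\<i> * of_real (s k l) * z) - exp (\<i> * of_real (s k l) * u))"
      if "l \<in> I k" for l
      using w[OF that] by (simp add: right_diff_distrib[symmetric] norm_mult)
    have "cmod (exp_sum (I k) (w k) (s k) z - exp_sum (I k) (w k) (s k) u) \<le> (\<Sum>l\<in>I k. ?d l)"
      unfolding exp_sum_def sum_subtractf[symmetric] by (rule norm_sum)
    also have "\<dots> \<le> (\<Sum>l\<in>I k. w k l * ((\<bar>R\<bar> + 1) * d) + 2 * (if R < s k l then w k l else 0))"
    proof (rule sum_mono)
      fix l assume l: "l \<in> I k"
      show "?d l \<le> w k l * ((\<bar>R\<bar> + 1) * d) + 2 * (if R < s k l then w k l else 0)"
      proof (cases "R < s k l")
        case True
        have "cmod (exp (\<i> * of_real (s k l) * z) - exp (\<i> * of_real (s k l) * u)) \<le> 1 + 1"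
          by (rule order_trans[OF norm_triangle_ineq4]) (intro add_mono norm_exp_upper s l z u)
        then have "?d l \<le> w k l * 2" unfolding d_eq[OF l] using w[OF l] by (intro mult_left_mono) auto
        moreover have "0 \<le> w k l * ((\<bar>R\<bar> + 1) * d)" using w[OF l] d by simp
        ultimately show ?thesis using True by simp
      next
        case False
        have "s k l * cmod (z - u) \<le> (\<bar>R\<bar> + 1) * d"
          using False s[OF l] zu by (intro mult_mono) auto
        with norm_exp_diff_upper[OF s[OF l] z u]
        have "?d l \<le> w k l * ((\<bar>R\<bar> + 1) * d)"
          unfolding d_eq[OF l] using w[OF l] by (intro mult_left_mono) auto
        then show ?thesis using False by simp
      qed
    qed
    also have "\<dots> = sum (w k) (I k) * ((\<bar>R\<bar> + 1) * d) + 2 * (\<Sum>l | l \<in> I k \<and> R < s k l. w k l)"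
      using fin by (simp add: sum.distrib sum_distrib_right sum_distrib_left sum.inter_filter)
    also have "\<dots> \<le> (C + 1) * ((\<bar>R\<bar> + 1) * d) + 2 * (e / 8)"
      using mass[of k] R[of k] d by (intro add_mono mult_right_mono mult_left_mono) auto
    also have "(C + 1) * ((\<bar>R\<bar> + 1) * d) = e / 4"
      using C0 by (simp add: d_def divide_simps)
    finally show "cmod (exp_sum (I k) (w k) (s k) z - exp_sum (I k) (w k) (s k) u) < e"
      using e by linarith
  qed
qed

text \<open>Arzela-Ascoli in pointwise form, which also covers unbounded sets: a diagonal sequence
  converges on a countable dense subset, and the common modulus of continuity carries convergence to
  the rest and continuity to the limit.\<close>

lemma equicontinuous_pointwise_subsequence:
  fixes G :: "nat \<Rightarrow> complex \<Rightarrow> complex"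
  assumes bound: "\<And>k z. z \<in> H \<Longrightarrow> cmod (G k z) \<le> C"
    and equi: "\<And>e. 0 < e \<Longrightarrow> \<exists>d>0. \<forall>k. \<forall>z\<in>H. \<forall>u\<in>H. cmod (z - u) < d \<longrightarrow> cmod (G k z - G k u) < e"
  obtains r F where "strict_mono (r :: nat \<Rightarrow> nat)" "continuous_on H F"
    "\<And>z. z \<in> H \<Longrightarrow> (\<lambda>k. G (r k) z) \<longlonglongrightarrow> F z"
proof -
  obtain T where T: "countable T" "T \<subseteq> H" "H \<subseteq> closure T" using separable by metis
  obtain r where r: "strict_mono (r :: nat \<Rightarrow> nat)" "\<And>z. z \<in> T \<Longrightarrow> \<exists>y. (\<lambda>k. G (r k) z) \<longlonglongrightarrow> y"
    using function_convergent_subsequence[of T G C] T bound by (metis subsetD)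
  have "\<exists>y. (\<lambda>k. G (r k) z) \<longlonglongrightarrow> y" if z: "z \<in> H" for z
  proof -
    have "Cauchy (\<lambda>k. G (r k) z)"
    proof (rule metric_CauchyI)
      fix e :: real assume e: "0 < e"
      obtain d where d: "0 < d" "\<And>k z u. z \<in> H \<Longrightarrow> u \<in> H \<Longrightarrow> cmod (z - u) < d \<Longrightarrow> cmod (G k z - G k u) < e / 3"
        using equi[of "e / 3"] e by auto
      obtain u where u: "u \<in> T" "dist u z < d" using T(3) z d(1) closure_approachable by blast
      have zu: "dist (G k z) (G k u) < e / 3" for k
        using d(2)[OF z, of u k] u T(2) by (auto simp: dist_norm norm_minus_commute)
      have "Cauchy (\<lambda>k. G (r k) u)" using r(2)[OF u(1)] convergent_eq_Cauchy by blast
      then obtain N where N: "\<And>m n. m \<ge> N \<Longrightarrow> n \<ge> N \<Longrightarrow> dist (G (r m) u) (G (r n) u) < e / 3"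
        using metric_CauchyD[of _ "e / 3"] e by (metis divide_pos_pos zero_less_numeral)
      have "dist (G (r m) z) (G (r n) z) < e" if "m \<ge> N" "n \<ge> N" for m n
      proof -
        have "dist (G (r m) z) (G (r n) z) \<le> dist (G (r m) z) (G (r m) u)
            + dist (G (r m) u) (G (r n) u) + dist (G (r n) z) (G (r n) u)"
          using dist_triangle[of "G (r m) z" "G (r n) z" "G (r m) u"]
            dist_triangle[of "G (r m) u" "G (r n) z" "G (r n) u"] by (simp add: dist_commute)
        then show ?thesis using zu[of "r m"] zu[of "r n"] N[OF that] by linarith
      qed
      then show "\<exists>N. \<forall>m\<ge>N. \<forall>n\<ge>N. dist (G (r m) z) (G (r n) z) < e" by blast
    qed
    then show ?thesis using convergent_eq_Cauchy by blast
  qed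
  then obtain F where F: "\<And>z. z \<in> H \<Longrightarrow> (\<lambda>k. G (r k) z) \<longlonglongrightarrow> F z" by metis
  have "continuous_on H F"
    unfolding continuous_on_iff
  proof (intro ballI allI impI)
    fix z and e :: real assume z: "z \<in> H" and e: "0 < e"
    obtain d where d: "0 < d" "\<And>k z u. z \<in> H \<Longrightarrow> u \<in> H \<Longrightarrow> cmod (z - u) < d \<Longrightarrow> cmod (G k z - G k u) < e / 2"
      using equi[of "e / 2"] e by auto
    have "dist (F u) (F z) < e" if u: "u \<in> H" "dist u z < d" for u
    proof -
      have "cmod (F u - F z) \<le> e / 2"
      proof (rule LIMSEQ_le_const2)
        show "(\<lambda>k. cmod (G (r k) u - G (r k) z)) \<longlonglongrightarrow> cmod (F u - F z)"
          by (intro tendsto_intros F u z)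
        show "\<exists>N. \<forall>k\<ge>N. cmod (G (r k) u - G (r k) z) \<le> e / 2"
          using d(2)[OF u(1) z] u(2) by (auto simp: dist_norm intro!: less_imp_le)
      qed
      then show ?thesis using e by (simp add: dist_norm)
    qed
    then show "\<exists>d>0. \<forall>u\<in>H. dist u z < d \<longrightarrow> dist (F u) (F z) < e" using d(1) by blast
  qed
  with r F that show ?thesis by blast
qed

text \<open>Two kinds of compactness are combined. Equicontinuity gives a limit that is continuous
  up to the boundary, and Montel's theorem supplies holomorphy inside.\<close>

lemma exp_sum_limit:
  assumes fin: "\<And>k. finite (I k)"
    and w: "\<And>k l. l \<in> I k \<Longrightarrow> 0 \<le> w k l" and s: "\<And>k l. l \<in> I k \<Longrightarrow> 0 \<le> s k l"
    and mass: "\<And>k. sum (w k) (I k) \<le> C"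
    and tight: "\<And>e. 0 < e \<Longrightarrow> \<exists>R. \<forall>k. (\<Sum>l | l \<in> I k \<and> R < s k l. w k l) \<le> e"
  obtains r F where "strict_mono (r :: nat \<Rightarrow> nat)"
    "continuous_on {z. 0 \<le> Im z} F" "F holomorphic_on {z. 0 < Im z}"
    "\<And>z. 0 \<le> Im z \<Longrightarrow> cmod (F z) \<le> C"
    "\<And>z. 0 \<le> Im z \<Longrightarrow> (\<lambda>k. exp_sum (I (r k)) (w (r k)) (s (r k)) z) \<longlonglongrightarrow> F z"
proof -
  define G where "G k = exp_sum (I k) (w k) (s k)" for k
  have bound: "cmod (G k z) \<le> C" if "0 \<le> Im z" for k z
    using order_trans[OF norm_exp_sum_le mass] w s that unfolding G_def by blast
  have equi: "\<exists>d>0. \<forall>k. \<forall>z\<in>{z. 0 \<le> Im z}. \<forall>u\<in>{z. 0 \<le> Im z}. cmod (z - u) < d \<longrightarrow> cmod (G k z - G k u) < e"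
    if "0 < e" for e
    using exp_sum_equicontinuous[OF fin w s mass tight that] unfolding G_def by (metis mem_Collect_eq)
  obtain r F where r: "strict_mono (r :: nat \<Rightarrow> nat)" and F: "continuous_on {z. 0 \<le> Im z} F"
      "\<And>z. z \<in> {z. 0 \<le> Im z} \<Longrightarrow> (\<lambda>k. G (r k) z) \<longlonglongrightarrow> F z"
  proof (rule equicontinuous_pointwise_subsequence[of "{z. 0 \<le> Im z}" G C])
    show "cmod (G k z) \<le> C" if "z \<in> {z. 0 \<le> Im z}" for k z using bound that by simp
  qed (use equi that in auto)
  have op: "open {z. 0 < Im z}" by (rule open_halfspace_Im_gt)
  have hol: "G k holomorphic_on {z. 0 < Im z}" for k
    unfolding G_def exp_sum_def by (intro holomorphic_intros)
  \<comment> \<open>The further subsequence only identifies \<open>F\<close> with a holomorphic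
    function; the conclusion keeps \<open>r\<close>.\<close>
  obtain g q where g: "g holomorphic_on {z. 0 < Im z}" "strict_mono (q :: nat \<Rightarrow> nat)"
      "\<And>z. z \<in> {z. 0 < Im z} \<Longrightarrow> (\<lambda>n. G (r (q n)) z) \<longlonglongrightarrow> g z"
  proof (rule Montel[OF op, of "range G" "\<lambda>k. G (r k)"])
    show "h holomorphic_on {z. 0 < Im z}" if "h \<in> range G" for h using that hol by auto
    show "\<exists>B. \<forall>h\<in>range G. \<forall>z\<in>K. cmod (h z) \<le> B" if "compact K" "K \<subseteq> {z. 0 < Im z}" for K
      using that(2) bound by (intro exI[of _ C]) (auto simp: less_imp_le subset_iff)
  qed (use that in auto)
  have "F z = g z" if "z \<in> {z. 0 < Im z}" for z
  proof (rule LIMSEQ_unique)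
    show "(\<lambda>n. G (r (q n)) z) \<longlonglongrightarrow> F z"
      using LIMSEQ_subseq_LIMSEQ[OF F(2) g(2), of z] that by (simp add: o_def)
  qed (rule g(3)[OF that])
  then have holF: "F holomorphic_on {z. 0 < Im z}" using g(1) holomorphic_cong by (metis (no_types, lifting))
  have "cmod (F z) \<le> C" if "0 \<le> Im z" for z
    by (rule LIMSEQ_le_const2[OF tendsto_norm[OF F(2)]]) (use that bound in auto)
  with that[OF r F(1) holF] F(2) show ?thesis unfolding G_def by simp
qed

section \<open>Factorization\<close>

lemma bounded_holomorphic_ext_reflect:
  assumes "bounded_holomorphic_ext_upper \<phi>"
  shows "bounded_holomorphic_ext_lower (\<lambda>x. \<phi> (- x))"
proof -
  obtain F where F: "continuous_on {z. 0 \<le> Im z} F" "F holomorphic_on {z. 0 < Im z}"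
      "bounded (F ` {z. 0 < Im z})" "\<And>x. F (complex_of_real x) = \<phi> x"
    using assms unfolding bounded_holomorphic_ext_upper_def by blast
  show ?thesis unfolding bounded_holomorphic_ext_lower_def
  proof (intro exI[of _ "\<lambda>z. F (- z)"] conjI allI)
    show "continuous_on {z. Im z \<le> 0} (\<lambda>z. F (- z))"
      by (intro continuous_on_compose2[OF F(1)] continuous_intros) auto
    show "(\<lambda>z. F (- z)) holomorphic_on {z. Im z < 0}"
    proof -
      have "(\<lambda>z :: complex. - z) holomorphic_on {z. Im z < 0}" by (intro holomorphic_intros)
      from holomorphic_on_compose_gen[OF this F(2)] show ?thesis by (simp add: o_def image_subset_iff)
    qed
    have "(\<lambda>z. F (- z)) ` {z. Im z < 0} \<subseteq> F ` {z. 0 < Im z}" by auto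
    then show "bounded ((\<lambda>z. F (- z)) ` {z. Im z < 0})" using F(3) bounded_subset by blast
    show "F (- complex_of_real x) = \<phi> (- x)" for x using F(4)[of "- x"] by simp
  qed
qed

text \<open>The extra factor carries the constant and the drift. Its character extends to exp(\<i> *
  b * z), which has modulus at most 1 on the upper half plane because \<open>b\<close> is
  nonnegative.\<close>

lemma bounded_holomorphic_ext_upper_exp:
  assumes G: "continuous_on {z. 0 \<le> Im z} G" "G holomorphic_on {z. 0 < Im z}"
      "\<And>z. 0 \<le> Im z \<Longrightarrow> cmod (G z) \<le> C" and b: "0 \<le> b"
  shows "bounded_holomorphic_ext_upper (\<lambda>x. exp (G (of_real x)) * (complex_of_real a * cis (b * x)))"
  unfolding bounded_holomorphic_ext_upper_def
proof (intro exI[of _ "\<lambda>z. exp (G z) * (complex_of_real a * exp (\<i> * of_real b * z))"] conjI allI)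
  show "continuous_on {z. 0 \<le> Im z} (\<lambda>z. exp (G z) * (complex_of_real a * exp (\<i> * of_real b * z)))"
    by (intro continuous_intros G)
  show "(\<lambda>z. exp (G z) * (complex_of_real a * exp (\<i> * of_real b * z))) holomorphic_on {z. 0 < Im z}"
    by (intro holomorphic_intros G)
  have "cmod (exp (G z) * (complex_of_real a * exp (\<i> * of_real b * z))) \<le> exp C * (\<bar>a\<bar> * 1)" if "0 < Im z" for z
  proof -
    have "cmod (exp (G z)) \<le> exp C"
      using norm_exp[of "G z"] G(3)[of z] that by (meson exp_le_cancel_iff less_imp_le order_trans)
    moreover have "cmod (exp (\<i> * of_real b * z)) \<le> 1" using b that by (intro norm_exp_upper) auto
    ultimately show ?thesis unfolding norm_mult by (intro mult_mono) auto
  qed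
  then show "bounded ((\<lambda>z. exp (G z) * (complex_of_real a * exp (\<i> * of_real b * z))) ` {z. 0 < Im z})"
    unfolding bounded_iff by blast
  show "exp (G (of_real x)) * (complex_of_real a * exp (\<i> * of_real b * of_real x))
      = exp (G (of_real x)) * (complex_of_real a * cis (b * x))" for x
    by (simp add: cis_conv_exp mult.assoc)
qed

lemma sum_symmetric_int:
  "(\<Sum>l\<in>{- int p..int p}. f l) = f 0 + (\<Sum>l\<in>{1..int p}. f l) + (\<Sum>l\<in>{1..int p}. f (- l) :: 'a::comm_monoid_add)"
proof -
  have "{- int p..int p} = insert 0 ({1..int p} \<union> uminus ` {1..int p})"
  proof (intro equalityI subsetI)
    fix l assume "l \<in> {- int p..int p}"
    then show "l \<in> insert 0 ({1..int p} \<union> uminus ` {1..int p})"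
      by (cases "l < 0") (auto intro: image_eqI[of _ _ "- l"])
  qed auto
  also have "sum f \<dots> = f 0 + sum f ({1..int p} \<union> uminus ` {1..int p})"
    by (rule sum.insert) auto
  also have "sum f ({1..int p} \<union> uminus ` {1..int p}) = sum f {1..int p} + sum f (uminus ` {1..int p})"
    by (rule sum.union_disjoint) auto
  also have "sum f (uminus ` {1..int p}) = (\<Sum>l\<in>{1..int p}. f (- l))"
    by (subst sum.reindex) (simp_all add: o_def)
  finally show ?thesis by (simp add: add.assoc)
qed

lemma exp_sum_cnj: "exp_sum I w s (- of_real x) = cnj (exp_sum I w s (of_real x))"
  by (simp add: exp_sum_def exp_cnj)

text \<open>Negative frequencies are reflected, so that \<open>G\<close> also lives on the upper
  half plane and enters at minus x; the same limit argument then serves both halves. The bound 2 * B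
  is \<open>B\<close> from the value at the origin plus \<open>B\<close> from the weight at
  frequency zero.\<close>

lemma bounded_cond_positive_definite_decomposition:
  assumes cpd: "cond_positive_definite \<psi>" and herm: "\<And>x. \<psi> (- x) = cnj (\<psi> x)"
    and B: "\<And>x. cmod (\<psi> x) \<le> B" and cont: "continuous_on UNIV \<psi>"
  obtains c :: real and F G :: "complex \<Rightarrow> complex" where
    "continuous_on {z. 0 \<le> Im z} F" "F holomorphic_on {z. 0 < Im z}"
    "\<And>z. 0 \<le> Im z \<Longrightarrow> cmod (F z) \<le> 2 * B" "positive_definite_fun (\<lambda>x. exp (F (of_real x)))"
    "continuous_on {z. 0 \<le> Im z} G" "G holomorphic_on {z. 0 < Im z}"
    "\<And>z. 0 \<le> Im z \<Longrightarrow> cmod (G z) \<le> 2 * B" "positive_definite_fun (\<lambda>x. exp (G (of_real x)))"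
    "\<And>x. \<psi> x = of_real c + F (of_real x) + G (- of_real x)"
proof -
  have B0: "0 \<le> B" using B[of 0] norm_ge_zero order_trans by blast
  \<comment> \<open>With mesh 1 / (k + 1), a fixed x sits near lattice index x * (k + 1). The
    relative wrap-around error is then of order 1 / (k + 1), although the lattice gets
    finer.\<close>
  define p where "p k = (Suc k)\<^sup>2" for k
  define M where "M k = 2 * p k + 1" for k
  define I where "I k = {1..int (p k)}" for k
  define good where "good k w \<longleftrightarrow>
    (\<forall>l. l \<in> {- int (p k)..int (p k)} \<longrightarrow> l \<noteq> 0 \<longrightarrow> 0 \<le> w l) \<and> \<bar>w 0\<bar> \<le> B \<and>
    (\<forall>a\<le>M k. cmod ((\<Sum>l\<in>{- int (p k)..int (p k)}. complex_of_real (w l) *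
        cis (2 * pi * of_int (l * int a) / real (M k))) - \<psi> (real a * inverse (real (Suc k))))
      \<le> 2 * B * real a / real (M k))" for k w
  have "\<exists>w. good k w" for k
    unfolding good_def M_def
    by (rule cyclic_Fejer_weights[OF cpd herm B, of "p k" "inverse (real (Suc k))"]) blast
  then obtain w where good: "\<And>k. good k (w k)" by metis
  have w: "\<And>k l. l \<in> {- int (p k)..int (p k)} \<Longrightarrow> l \<noteq> 0 \<Longrightarrow> 0 \<le> w k l"
    and w0: "\<And>k. \<bar>w k 0\<bar> \<le> B"
    and approx: "\<And>k a. a \<le> M k \<Longrightarrow> cmod ((\<Sum>l\<in>{- int (p k)..int (p k)}. complex_of_real (w k l) *
        cis (2 * pi * of_int (l * int a) / real (M k))) - \<psi> (real a * inverse (real (Suc k))))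
      \<le> 2 * B * real a / real (M k)"
    using good unfolding good_def by blast+
  define v where "v k l = w k (- l)" for k l
  \<comment> \<open>The real frequency that agrees with the cyclic character \<open>l\<close> at
    lattice points of mesh 1 / (k + 1).\<close>
  define s where "s k l = 2 * pi * of_int l * real (Suc k) / real (M k)" for k l
  define E where "E k x = complex_of_real (w k 0) + exp_sum (I k) (w k) (s k) (of_real x)
    + exp_sum (I k) (v k) (s k) (- of_real x)" for k x
  have fin: "finite (I k)" for k by (simp add: I_def)
  have wpos: "0 \<le> w k l" if "l \<in> I k" for k l using w[of l k] that by (simp add: I_def)
  have vpos: "0 \<le> v k l" if "l \<in> I k" for k l using w[of "- l" k] that by (simp add: I_def v_def)
  have spos: "0 \<le> s k l" if "l \<in> I k" for k l using that by (simp add: I_def s_def)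
  have MN: "2 * (real (Suc k))\<^sup>2 \<le> real (M k)" for k by (simp add: M_def p_def)
  have M0: "0 < real (M k)" for k by (simp add: M_def)

  have E_lattice: "E k (real a * inverse (real (Suc k))) = (\<Sum>l\<in>{- int (p k)..int (p k)}. complex_of_real (w k l) *
        cis (2 * pi * of_int (l * int a) / real (M k)))" for k a
  proof -
    have e: "exp (\<i> * of_real (s k l) * of_real (real a * inverse (real (Suc k))))
        = cis (2 * pi * of_int (l * int a) / real (M k))" for l
    proof -
      have "s k l * (real a * inverse (real (Suc k))) = 2 * pi * of_int (l * int a) / real (M k)"
        by (simp add: s_def del: of_nat_Suc)
      moreover have "exp (\<i> * of_real x * of_real y) = cis (x * y)" for x y by (simp add: cis_conv_exp mult.assoc)
      ultimately show ?thesis by (simp only:)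
    qed
    have e': "exp (\<i> * of_real (s k l) * - of_real (real a * inverse (real (Suc k))))
        = cis (2 * pi * of_int (- l * int a) / real (M k))" for l
      using e[of "- l"] by (simp add: s_def)
    show ?thesis
      unfolding E_def exp_sum_def e e' sum_symmetric_int I_def v_def by simp
  qed
  have E_error: "cmod (E k (real a * inverse (real (Suc k))) - \<psi> (real a * inverse (real (Suc k)))) \<le> B * real a / (real (Suc k))\<^sup>2"
    if "a \<le> M k" for k a
  proof -
    have "2 * B * real a / real (M k) \<le> 2 * B * real a / (2 * (real (Suc k))\<^sup>2)"
      using MN[of k] B0 by (intro divide_left_mono mult_pos_pos M0) (auto simp del: of_nat_Suc)
    also have "\<dots> = B * real a / (real (Suc k))\<^sup>2" by simp
    finally show ?thesis using approx[OF that] unfolding E_lattice by linarith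
  qed

  \<comment> \<open>At lattice index 0 there is no wrap-around, so the weights add up to \<psi> 0
    exactly.\<close>
  have total: "w k 0 + sum (w k) (I k) + sum (v k) (I k) = Re (\<psi> 0)" "E k 0 = \<psi> 0" for k
  proof -
    show *: "E k 0 = \<psi> 0" using E_error[of 0 k] by simp
    have "E k 0 = complex_of_real (w k 0 + sum (w k) (I k) + sum (v k) (I k))"
      by (simp add: E_def exp_sum_def)
    with * show "w k 0 + sum (w k) (I k) + sum (v k) (I k) = Re (\<psi> 0)" by (metis Re_complex_of_real)
  qed
  have mass: "sum (w k) (I k) \<le> 2 * B" "sum (v k) (I k) \<le> 2 * B" for k
  proof -
    have "0 \<le> sum (w k) (I k)" "0 \<le> sum (v k) (I k)" by (simp_all add: sum_nonneg wpos vpos)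
    moreover have "Re (\<psi> 0) \<le> B" using B[of 0] complex_Re_le_cmod order_trans by blast
    ultimately show "sum (w k) (I k) \<le> 2 * B" "sum (v k) (I k) \<le> 2 * B"
      using total(1)[of k] w0[of k] by linarith+
  qed

  \<comment> \<open>The cutoff \<open>R\<close> must not depend on \<open>k\<close>. Finitely many
    small \<open>k\<close> are handled by the largest frequency present, the others by averaging.
    Nonnegativity of \<open>R\<close> keeps out frequency zero, whose weight has no sign.\<close>
  have tail: "\<exists>R\<ge>0. \<forall>k. (\<Sum>l | l \<in> {- int (p k)..int (p k)} \<and> R < \<bar>s k l\<bar>. w k l) \<le> e" if e: "0 < e" for e
  proof -
    have "isCont \<psi> 0" using cont by (simp add: continuous_on_eq_continuous_at)
    then have "\<exists>d>0. \<forall>y. \<bar>y\<bar> < d \<longrightarrow> cmod (\<psi> y - \<psi> 0) < e / 8"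
      unfolding continuous_at_eps_delta dist_norm diff_zero real_norm_def using e
      by (elim allE[of _ "e / 8"]) simp
    then obtain d where d: "0 < d" "\<And>y. \<bar>y\<bar> < d \<Longrightarrow> cmod (\<psi> y - \<psi> 0) < e / 8" by blast
    define \<eta> where "\<eta> = min d 1"
    have \<eta>: "0 < \<eta>" "\<eta> \<le> 1" "\<And>y. \<bar>y\<bar> < \<eta> \<Longrightarrow> cmod (\<psi> y - \<psi> 0) < e / 8"
      using d by (auto simp: \<eta>_def)
    \<comment> \<open>From this index on, at least one lattice step fits below \<eta>, and
      wrap-around costs at most e / 8 within distance \<eta> of the origin.\<close>
    obtain K :: nat where K: "max (1 / \<eta>) (8 * B * \<eta> / e) \<le> real K" using real_arch_simple by blast
    \<comment> \<open>All frequencies at stage \<open>k\<close> are at most pi * (k + 1), which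
      gives the second entry. The first makes |l| * \<eta> * (k + 1) exceed 4 * M, and rounding
      \<eta> * (k + 1) down to \<open>n\<close> loses at most a factor 2.\<close>
    define R where "R = max (8 * pi / \<eta>) (pi * real (Suc K))"
    have R0: "0 \<le> R" unfolding R_def by (simp add: le_max_iff_disj)
    have "(\<Sum>l | l \<in> {- int (p k)..int (p k)} \<and> R < \<bar>s k l\<bar>. w k l) \<le> e" for k
    proof (cases "k < K")
      case True
      have "\<not> R < \<bar>s k l\<bar>" if "l \<in> {- int (p k)..int (p k)}" for l
      proof -
        have "2 * \<bar>real_of_int l\<bar> \<le> real (M k)" using that by (auto simp: M_def)
        then have "pi * real (Suc k) * (2 * \<bar>real_of_int l\<bar>) \<le> pi * real (Suc k) * real (M k)"
          by (intro mult_left_mono) auto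
        then have "\<bar>s k l\<bar> \<le> pi * real (Suc k)"
          using M0[of k] by (simp add: s_def abs_mult abs_divide divide_le_eq algebra_simps del: of_nat_Suc)
        also have "\<dots> \<le> R" using True by (auto simp: R_def le_max_iff_disj)
        finally show ?thesis by simp
      qed
      then have "{l. l \<in> {- int (p k)..int (p k)} \<and> R < \<bar>s k l\<bar>} = {}" by blast
      then show ?thesis using e by (simp only: sum.empty less_imp_le)
    next
      case False
      let ?N = "real (Suc k)"
      have N: "1 \<le> \<eta> * ?N" "8 * B * \<eta> \<le> e * ?N"
      proof -
        have "1 / \<eta> \<le> ?N" "8 * B * \<eta> / e \<le> ?N" using K False by auto
        then show "1 \<le> \<eta> * ?N" "8 * B * \<eta> \<le> e * ?N"
          using \<eta>(1) e by (simp_all add: divide_le_eq mult.commute)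
      qed
      \<comment> \<open>The points a / (k + 1) with a < n lie within \<eta> of the origin, where
        \<psi> is close to \<psi> 0.\<close>
      define n where "n = nat \<lfloor>\<eta> * ?N\<rfloor>"
      have n1: "real n \<le> \<eta> * ?N" "\<eta> * ?N < real n + 1" using N(1) by (auto simp: n_def simp del: of_nat_Suc)
      have n0: "0 < n" using N(1) n1(2) by (cases n) auto
      have n2: "\<eta> * ?N \<le> 2 * real n" using n1(2) n0 by linarith
      have bound: "cmod ((\<Sum>l\<in>{- int (p k)..int (p k)}. complex_of_real (w k l) *
          cis (2 * pi * of_int (l * int a) / real (M k))) - \<psi> 0) \<le> e / 4" if "a < n" for a
      proof -
        have a: "real a < \<eta> * ?N" using that n1(1) by (meson less_le_trans of_nat_less_iff)
        then have "\<bar>real a * inverse ?N\<bar> < \<eta>" by (simp add: divide_simps mult.commute del: of_nat_Suc)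
        then have 1: "cmod (\<psi> (real a * inverse ?N) - \<psi> 0) < e / 8" by (rule \<eta>(3))
        have "2 * B * real a / real (M k) \<le> 2 * B * real a / (2 * ?N\<^sup>2)"
          using MN[of k] B0 by (intro divide_left_mono mult_pos_pos M0) (auto simp del: of_nat_Suc)
        also have "\<dots> \<le> 2 * B * (\<eta> * ?N) / (2 * ?N\<^sup>2)"
          using a B0 by (intro divide_right_mono mult_left_mono) auto
        also have "\<dots> = B * \<eta> / ?N" by (simp add: power2_eq_square del: of_nat_Suc)
        also have "\<dots> \<le> e / 8" using N(2) by (simp add: divide_le_eq mult_ac del: of_nat_Suc)
        finally have 2: "2 * B * real a / real (M k) \<le> e / 8" .
        have "\<eta> * ?N \<le> 1 * ?N" "1 * ?N \<le> ?N * ?N" using \<eta>(2) by (auto intro!: mult_right_mono)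
        then have "real a \<le> real (M k)"
          using a MN[of k] zero_le_power2[of ?N] unfolding power2_eq_square by linarith
        then have aM: "a \<le> M k" by simp
        let ?S = "\<Sum>l\<in>{- int (p k)..int (p k)}. complex_of_real (w k l) * cis (2 * pi * of_int (l * int a) / real (M k))"
        have "cmod (?S - \<psi> 0) \<le> cmod (?S - \<psi> (real a * inverse ?N)) + cmod (\<psi> (real a * inverse ?N) - \<psi> 0)"
          using norm_triangle_ineq[of "?S - \<psi> (real a * inverse ?N)" "\<psi> (real a * inverse ?N) - \<psi> 0"] by simp
        then show ?thesis using approx[OF aM] 1 2 by linarith
      qed
      have "(\<Sum>l | l \<in> {- int (p k)..int (p k)} \<and> R < \<bar>s k l\<bar>. w k l)
          \<le> (\<Sum>l | l \<in> {- int (p k)..int (p k)} \<and> 2 * M k \<le> nat \<bar>l\<bar> * n. w k l)"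
      proof (rule sum_mono2)
        show "finite {l. l \<in> {- int (p k)..int (p k)} \<and> 2 * M k \<le> nat \<bar>l\<bar> * n}" by (rule finite_subset[of _ "{- int (p k)..int (p k)}"]) auto
        show "{l. l \<in> {- int (p k)..int (p k)} \<and> R < \<bar>s k l\<bar>} \<subseteq> {l. l \<in> {- int (p k)..int (p k)} \<and> 2 * M k \<le> nat \<bar>l\<bar> * n}"
        proof (intro Collect_mono impI, elim conjE, intro conjI)
          fix l assume l: "R < \<bar>s k l\<bar>"
          have "8 * pi / \<eta> < \<bar>s k l\<bar>" using l by (simp add: R_def)
          then have "8 * pi * real (M k) < 2 * pi * \<bar>of_int l\<bar> * ?N * \<eta>"
            using \<eta>(1) M0[of k] by (simp add: s_def abs_mult abs_divide divide_simps algebra_simps del: of_nat_Suc)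
          also have "\<dots> = pi * (2 * \<bar>of_int l\<bar> * (\<eta> * ?N))" by simp
          also have "\<dots> \<le> pi * (2 * \<bar>of_int l\<bar> * (2 * real n))"
            using n2 by (intro mult_left_mono) auto
          finally have "pi * (8 * real (M k)) < pi * (4 * (\<bar>of_int l\<bar> * real n))" by simp
          then have "8 * real (M k) < 4 * (\<bar>of_int l\<bar> * real n)" by (simp only: mult_less_cancel_left_pos pi_gt_zero)
          then have "real (2 * M k) < real (nat \<bar>l\<bar> * n)" by (simp add: mult.commute)
          then show "2 * M k \<le> nat \<bar>l\<bar> * n" by (simp only: of_nat_less_iff less_imp_le)
        qed assumption
        fix l assume l: "l \<in> {l. l \<in> {- int (p k)..int (p k)} \<and> 2 * M k \<le> nat \<bar>l\<bar> * n} - {l. l \<in> {- int (p k)..int (p k)} \<and> R < \<bar>s k l\<bar>}"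
        then have "l \<noteq> 0" by (auto simp: M_def)
        then show "0 \<le> w k l" using l by (intro w) auto
      qed
      also have "\<dots> \<le> 4 * (e / 4)"
        by (rule Fejer_weights_tail[OF _ w bound n0]) (simp_all add: M_def)
      finally show ?thesis by simp
    qed
    with R0 show ?thesis by blast
  qed
  have tight_w: "\<exists>R. \<forall>k. (\<Sum>l | l \<in> I k \<and> R < s k l. w k l) \<le> e" if e: "0 < e" for e
  proof -
    obtain R where R: "\<And>k. (\<Sum>l | l \<in> {- int (p k)..int (p k)} \<and> R < \<bar>s k l\<bar>. w k l) \<le> e" "0 \<le> R"
      using tail[OF e] by blast
    have "(\<Sum>l | l \<in> I k \<and> R < s k l. w k l) \<le> e" for k
    proof (rule order_trans[OF sum_mono2 R(1)])
      show "finite {l. l \<in> {- int (p k)..int (p k)} \<and> R < \<bar>s k l\<bar>}" by (rule finite_subset[of _ "{- int (p k)..int (p k)}"]) auto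
      show "{l. l \<in> I k \<and> R < s k l} \<subseteq> {l. l \<in> {- int (p k)..int (p k)} \<and> R < \<bar>s k l\<bar>}" by (auto simp: I_def)
      fix l assume l: "l \<in> {l. l \<in> {- int (p k)..int (p k)} \<and> R < \<bar>s k l\<bar>} - {l. l \<in> I k \<and> R < s k l}"
      then have "l \<noteq> 0" using R(2) by (auto simp: s_def)
      then show "0 \<le> w k l" using l by (intro w) auto
    qed
    then show ?thesis by blast
  qed
  have tight_v: "\<exists>R. \<forall>k. (\<Sum>l | l \<in> I k \<and> R < s k l. v k l) \<le> e" if e: "0 < e" for e
  proof -
    obtain R where R: "\<And>k. (\<Sum>l | l \<in> {- int (p k)..int (p k)} \<and> R < \<bar>s k l\<bar>. w k l) \<le> e" "0 \<le> R"
      using tail[OF e] by blast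
    have "(\<Sum>l | l \<in> I k \<and> R < s k l. v k l) \<le> e" for k
    proof -
      have "(\<Sum>l | l \<in> I k \<and> R < s k l. v k l) = (\<Sum>l\<in>uminus ` {l. l \<in> I k \<and> R < s k l}. w k l)"
        by (simp add: sum.reindex v_def)
      also have "\<dots> \<le> e"
      proof (rule order_trans[OF sum_mono2 R(1)])
        show "finite {l. l \<in> {- int (p k)..int (p k)} \<and> R < \<bar>s k l\<bar>}" by (rule finite_subset[of _ "{- int (p k)..int (p k)}"]) auto
        show "uminus ` {l. l \<in> I k \<and> R < s k l} \<subseteq> {l. l \<in> {- int (p k)..int (p k)} \<and> R < \<bar>s k l\<bar>}"
          by (auto simp: I_def s_def)
        fix l assume l: "l \<in> {l. l \<in> {- int (p k)..int (p k)} \<and> R < \<bar>s k l\<bar>} - uminus ` {l. l \<in> I k \<and> R < s k l}"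
        then have "l \<noteq> 0" using R(2) by (auto simp: s_def)
        then show "0 \<le> w k l" using l by (intro w) auto
      qed
      finally show ?thesis .
    qed
    then show ?thesis by blast
  qed

  have E_uniform: "\<exists>d>0. \<forall>k x y. \<bar>x - y\<bar> < d \<longrightarrow> cmod (E k x - E k y) < e" if e: "0 < e" for e
  proof -
    obtain d1 where d1: "0 < d1" "\<And>k z u. 0 \<le> Im z \<Longrightarrow> 0 \<le> Im u \<Longrightarrow> cmod (z - u) < d1 \<Longrightarrow>
        cmod (exp_sum (I k) (w k) (s k) z - exp_sum (I k) (w k) (s k) u) < e / 2"
      using exp_sum_equicontinuous[OF fin wpos spos mass(1) tight_w, of "e / 2"] e by (metis half_gt_zero)
    obtain d2 where d2: "0 < d2" "\<And>k z u. 0 \<le> Im z \<Longrightarrow> 0 \<le> Im u \<Longrightarrow> cmod (z - u) < d2 \<Longrightarrow>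
        cmod (exp_sum (I k) (v k) (s k) z - exp_sum (I k) (v k) (s k) u) < e / 2"
      using exp_sum_equicontinuous[OF fin vpos spos mass(2) tight_v, of "e / 2"] e by (metis half_gt_zero)
    have "cmod (E k x - E k y) < e" if xy: "\<bar>x - y\<bar> < min d1 d2" for k x y
    proof -
      let ?A = "exp_sum (I k) (w k) (s k) (of_real x) - exp_sum (I k) (w k) (s k) (of_real y)"
      let ?B = "exp_sum (I k) (v k) (s k) (- of_real x) - exp_sum (I k) (v k) (s k) (- of_real y)"
      have "cmod (complex_of_real x - complex_of_real y) = \<bar>x - y\<bar>"
        by (simp flip: of_real_diff)
      moreover have "cmod (- complex_of_real x - - complex_of_real y) = \<bar>x - y\<bar>"
        by (simp add: abs_minus_commute flip: of_real_diff)
      ultimately have "cmod ?A < e / 2" "cmod ?B < e / 2"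
        using d1(2)[of "of_real x" "of_real y" k] d2(2)[of "- of_real x" "- of_real y" k] xy by simp_all
      moreover have "E k x - E k y = ?A + ?B" by (simp add: E_def)
      ultimately show ?thesis using norm_triangle_ineq[of ?A ?B] by simp
    qed
    then show ?thesis using d1(1) d2(1) by (intro exI[of _ "min d1 d2"]) auto
  qed

  \<comment> \<open>The sums approximate \<psi> only on the lattice. Lattice points
    \<open>y k\<close> approach \<open>x\<close>, and three errors vanish: equicontinuity of the
    sums, wrap-around at \<open>y k\<close>, and continuity of \<psi>.\<close>
  have E_lim_pos: "(\<lambda>k. E k x) \<longlonglongrightarrow> \<psi> x" if x: "0 \<le> x" for x
  proof -
    define a where "a k = nat \<lfloor>x * real (Suc k)\<rfloor>" for k
    define y where "y k = real (a k) * inverse (real (Suc k))" for k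
    have a: "real (a k) \<le> x * real (Suc k)" "x * real (Suc k) < real (a k) + 1" for k
      using x by (auto simp: a_def simp del: of_nat_Suc)
    have y: "\<bar>x - y k\<bar> \<le> inverse (real (Suc k))" for k
    proof -
      have "\<bar>x - y k\<bar> = \<bar>x * real (Suc k) - real (a k)\<bar> * inverse (real (Suc k))"
      proof -
        have "x - y k = (x * real (Suc k) - real (a k)) * inverse (real (Suc k))"
          by (simp add: y_def left_diff_distrib del: of_nat_Suc)
        then show ?thesis by (simp only: abs_mult) simp
      qed
      also have "\<dots> \<le> 1 * inverse (real (Suc k))" using a[of k] by (intro mult_right_mono) auto
      finally show ?thesis by simp
    qed
    have lim_inv: "(\<lambda>k. inverse (real (Suc k))) \<longlonglongrightarrow> 0" by (rule LIMSEQ_inverse_real_of_nat)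
    have xy: "(\<lambda>k. x - y k) \<longlonglongrightarrow> 0"
      by (rule Lim_null_comparison[OF _ lim_inv]) (use y in auto)
    then have "(\<lambda>k. x - (x - y k)) \<longlonglongrightarrow> x - 0" by (intro tendsto_intros)
    then have "y \<longlonglongrightarrow> x" by simp
    moreover have "isCont \<psi> x" using cont by (simp add: continuous_on_eq_continuous_at)
    ultimately have l1: "(\<lambda>k. \<psi> (y k)) \<longlonglongrightarrow> \<psi> x" by (rule isCont_tendsto_compose[rotated])
    obtain K :: nat where K: "x \<le> real K" using real_arch_simple by blast
    have l2: "(\<lambda>k. E k (y k) - \<psi> (y k)) \<longlonglongrightarrow> 0"
    proof (rule Lim_null_comparison)
      show "(\<lambda>k. B * x * inverse (real (Suc k))) \<longlonglongrightarrow> 0"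
        using tendsto_mult_left[OF lim_inv, of "B * x"] by simp
      show "\<forall>\<^sub>F k in sequentially. cmod (E k (y k) - \<psi> (y k)) \<le> B * x * inverse (real (Suc k))"
      proof (rule eventually_sequentiallyI)
        fix k assume "K \<le> k"
        then have "x \<le> real (Suc k)" using K by linarith
        then have "x * real (Suc k) \<le> real (Suc k) * real (Suc k)" by (intro mult_right_mono) auto
        then have "real (a k) \<le> real (M k)"
          using a(1)[of k] MN[of k] zero_le_power2[of "real (Suc k)"] unfolding power2_eq_square by linarith
        then have "a k \<le> M k" by simp
        then have "cmod (E k (y k) - \<psi> (y k)) \<le> B * real (a k) / (real (Suc k))\<^sup>2"
          unfolding y_def by (rule E_error)
        also have "\<dots> \<le> B * (x * real (Suc k)) / (real (Suc k))\<^sup>2"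
          using a(1)[of k] B0 by (intro divide_right_mono mult_left_mono) auto
        also have "\<dots> = B * x * inverse (real (Suc k))"
          by (simp add: power2_eq_square divide_inverse del: of_nat_Suc)
        finally show "cmod (E k (y k) - \<psi> (y k)) \<le> B * x * inverse (real (Suc k))" .
      qed
    qed
    have l3: "(\<lambda>k. E k x - E k (y k)) \<longlonglongrightarrow> 0"
    proof (rule LIMSEQ_I)
      fix e :: real assume "0 < e"
      then obtain d where d: "0 < d" "\<And>k x y. \<bar>x - y\<bar> < d \<Longrightarrow> cmod (E k x - E k y) < e"
        using E_uniform by blast
      obtain n0 where "\<forall>k\<ge>n0. norm (x - y k - 0) < d" using LIMSEQ_D[OF xy d(1)] by blast
      then have "\<forall>k\<ge>n0. norm (E k x - E k (y k) - 0) < e"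
        unfolding diff_0_right real_norm_def by (blast intro: d(2))
      then show "\<exists>n0. \<forall>k\<ge>n0. norm (E k x - E k (y k) - 0) < e" ..
    qed
    have "(\<lambda>k. (E k x - E k (y k)) + (E k (y k) - \<psi> (y k)) + \<psi> (y k)) \<longlonglongrightarrow> 0 + 0 + \<psi> x"
      by (intro tendsto_add l1 l2 l3)
    then show ?thesis by simp
  qed
  have E_lim: "(\<lambda>k. E k x) \<longlonglongrightarrow> \<psi> x" for x
  \<comment> \<open>Lattice indices are natural numbers, so negative arguments are reached by
    Hermitian symmetry.\<close>
  proof (cases "0 \<le> x")
    case False
    then have "(\<lambda>k. cnj (E k (- x))) \<longlonglongrightarrow> cnj (\<psi> (- x))" by (intro tendsto_intros E_lim_pos) simp
    moreover have "cnj (E k (- x)) = E k x" for k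
      using exp_sum_cnj[of "I k" "w k" "s k" x] exp_sum_cnj[of "I k" "v k" "s k" x] by (simp add: E_def)
    ultimately show ?thesis by (simp add: herm)
  qed (rule E_lim_pos)

  obtain r1 F where r1: "strict_mono (r1 :: nat \<Rightarrow> nat)"
    and F: "continuous_on {z. 0 \<le> Im z} F" "F holomorphic_on {z. 0 < Im z}"
      "\<And>z. 0 \<le> Im z \<Longrightarrow> cmod (F z) \<le> 2 * B"
      "\<And>z. 0 \<le> Im z \<Longrightarrow> (\<lambda>k. exp_sum (I (r1 k)) (w (r1 k)) (s (r1 k)) z) \<longlonglongrightarrow> F z"
    using exp_sum_limit[where I = I and w = w and s = s and C = "2 * B", OF fin wpos spos mass(1) tight_w] by blast
  have tight_v': "\<exists>R. \<forall>k. (\<Sum>l | l \<in> I (r1 k) \<and> R < s (r1 k) l. v (r1 k) l) \<le> e" if "0 < e" for e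
    using tight_v[OF that] by blast
  obtain r2 G where r2: "strict_mono (r2 :: nat \<Rightarrow> nat)"
    and G: "continuous_on {z. 0 \<le> Im z} G" "G holomorphic_on {z. 0 < Im z}"
      "\<And>z. 0 \<le> Im z \<Longrightarrow> cmod (G z) \<le> 2 * B"
      "\<And>z. 0 \<le> Im z \<Longrightarrow> (\<lambda>k. exp_sum (I (r1 (r2 k))) (v (r1 (r2 k))) (s (r1 (r2 k))) z) \<longlonglongrightarrow> G z"
    using exp_sum_limit[where I = "\<lambda>k. I (r1 k)" and w = "\<lambda>k. v (r1 k)" and s = "\<lambda>k. s (r1 k)" and C = "2 * B",
        OF fin vpos spos mass(2) tight_v'] by blast
  define r where "r k = r1 (r2 k)" for k
  have r: "strict_mono r" using r1 r2 by (simp add: r_def strict_mono_def)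
  have Fr: "(\<lambda>k. exp_sum (I (r k)) (w (r k)) (s (r k)) z) \<longlonglongrightarrow> F z" if "0 \<le> Im z" for z
    using LIMSEQ_subseq_LIMSEQ[OF F(4)[OF that] r2] by (simp add: r_def o_def)
  have Gr: "(\<lambda>k. exp_sum (I (r k)) (v (r k)) (s (r k)) z) \<longlonglongrightarrow> G z" if "0 \<le> Im z" for z
    using G(4)[OF that] by (simp add: r_def)
  have Er: "(\<lambda>k. E (r k) x) \<longlonglongrightarrow> \<psi> x" for x
    using LIMSEQ_subseq_LIMSEQ[OF E_lim r] by (simp add: o_def)
  \<comment> \<open>The weight at frequency zero converges as a difference of convergent sequences.
    It does not involve \<open>x\<close>, so the limit is the same real constant for every
    \<open>x\<close>.\<close>
  have w_lim: "(\<lambda>k. complex_of_real (w (r k) 0)) \<longlonglongrightarrow> \<psi> x - F (of_real x) - G (- of_real x)" for x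
  proof -
    have "(\<lambda>k. E (r k) x - exp_sum (I (r k)) (w (r k)) (s (r k)) (of_real x)
        - exp_sum (I (r k)) (v (r k)) (s (r k)) (- of_real x)) \<longlonglongrightarrow> \<psi> x - F (of_real x) - G (- of_real x)"
      by (intro tendsto_diff Er Fr Gr) auto
    then show ?thesis by (simp add: E_def)
  qed
  define c where "c = Re (\<psi> 0 - F 0 - G 0)"
  have "(\<lambda>k. complex_of_real (Re (complex_of_real (w (r k) 0)))) \<longlonglongrightarrow> complex_of_real c"
    unfolding c_def using w_lim[of 0] by (intro tendsto_of_real tendsto_Re) simp
  then have c_lim: "(\<lambda>k. complex_of_real (w (r k) 0)) \<longlonglongrightarrow> complex_of_real c" by simp
  show thesis
  proof (rule that[OF F(1,2,3) _ G(1,2,3)])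
    show "positive_definite_fun (\<lambda>x. exp (F (of_real x)))"
    proof (rule positive_definite_fun_limit)
      show "positive_definite_fun (\<lambda>x. exp (exp_sum (I (r k)) (w (r k)) (s (r k)) (of_real x)))" for k
        unfolding exp_sum_def by (intro positive_definite_fun_exp_sum fin wpos)
      show "(\<lambda>k. exp (exp_sum (I (r k)) (w (r k)) (s (r k)) (of_real x))) \<longlonglongrightarrow> exp (F (of_real x))" for x
        by (intro tendsto_intros Fr) simp
    qed
    show "positive_definite_fun (\<lambda>x. exp (G (of_real x)))"
    proof (rule positive_definite_fun_limit)
      show "positive_definite_fun (\<lambda>x. exp (exp_sum (I (r k)) (v (r k)) (s (r k)) (of_real x)))" for k
        unfolding exp_sum_def by (intro positive_definite_fun_exp_sum fin vpos)
      show "(\<lambda>k. exp (exp_sum (I (r k)) (v (r k)) (s (r k)) (of_real x))) \<longlonglongrightarrow> exp (G (of_real x))" for x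
        by (intro tendsto_intros Gr) simp
    qed
    show "\<psi> x = of_real c + F (of_real x) + G (- of_real x)" for x
      using LIMSEQ_unique[OF w_lim[of x] c_lim] by (simp add: algebra_simps)
  qed
qed

theorem theorem11:
  fixes f L :: "real \<Rightarrow> complex"
  assumes "L2_plus_const_fun f"
    and "\<exists>m M. 0 < m \<and> (\<forall>x. m \<le> cmod (f x) \<and> cmod (f x) \<le> M)"
    and "log_branch f L"
    and "\<And>r. 0 < r \<Longrightarrow> positive_definite_fun (branch_power L r)"
  shows "\<exists>\<Phi>\<^sub>p \<Phi>\<^sub>m. (\<forall>x. f x = \<Phi>\<^sub>p x * \<Phi>\<^sub>m x) \<and>
           positive_definite_fun \<Phi>\<^sub>p \<and> bounded_holomorphic_ext_upper \<Phi>\<^sub>p \<and>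
           positive_definite_fun \<Phi>\<^sub>m \<and> bounded_holomorphic_ext_lower \<Phi>\<^sub>m"
proof -
  have cont: "continuous_on UNIV L" and exp_L: "\<And>x. exp (L x) = f x"
    using assms(3) by (auto simp: log_branch_def)
  note cpd = cond_positive_definite_log(1)[OF assms(4)] and herm = cond_positive_definite_log(2)[OF assms(4)]
  obtain m M where mM: "0 < m" "\<And>x. m \<le> cmod (f x)" "\<And>x. cmod (f x) \<le> M" using assms(2) by blast
  define K where "K = \<bar>ln m\<bar> + \<bar>ln M\<bar>"
  have K: "\<bar>Re (L x)\<bar> \<le> K" for x
  proof -
    have "m \<le> exp (Re (L x))" "exp (Re (L x)) \<le> M"
      using mM(2,3)[of x] by (simp_all add: exp_L[symmetric] norm_exp_eq_Re)
    moreover from this have "0 < M" by (meson exp_gt_zero less_le_trans)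
    ultimately have "Re (L x) \<le> ln M" "ln m \<le> Re (L x)"
      using mM(1) ln_mono[of m "exp (Re (L x))"] by (simp_all add: ln_ge_iff)
    then show ?thesis unfolding K_def by linarith
  qed
  have cont_Im: "continuous_on UNIV (\<lambda>x. Im (L x))" by (intro continuous_intros cont)
  have odd_Im: "Im (L (- x)) = - Im (L x)" for x by (simp add: herm)
  have "\<exists>\<beta> D. \<forall>x. \<bar>Im (L x) - \<beta> * x\<bar> \<le> D"
  proof (rule quasi_additive_near_linear[OF cont_Im odd_Im cond_positive_definite_quasi_additive[OF cpd herm K]])
    fix \<beta> D assume "\<And>x. \<bar>Im (L x) - \<beta> * x\<bar> \<le> D"
    then show "\<exists>\<beta> D. \<forall>x. \<bar>Im (L x) - \<beta> * x\<bar> \<le> D" by (intro exI allI)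
  qed
  then obtain \<beta> D where D: "\<And>x. \<bar>Im (L x) - \<beta> * x\<bar> \<le> D" by blast
  define \<psi> where "\<psi> x = L x - \<i> * of_real (\<beta> * x)" for x
  have psi_bound: "cmod (\<psi> x) \<le> K + D" for x
    using cmod_le[of "\<psi> x"] K[of x] D[of x] by (simp add: \<psi>_def)
  have psi_cpd: "cond_positive_definite \<psi>"
    unfolding \<psi>_def by (rule cond_positive_definite_minus_drift[OF cpd])
  have psi_herm: "\<psi> (- x) = cnj (\<psi> x)" for x by (simp add: \<psi>_def herm)
  have psi_cont: "continuous_on UNIV \<psi>" unfolding \<psi>_def by (intro continuous_intros cont)
  show ?thesis
  proof (rule bounded_cond_positive_definite_decomposition[OF psi_cpd psi_herm psi_bound psi_cont])
    fix c :: real and F G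
    assume F: "continuous_on {z. 0 \<le> Im z} F" "F holomorphic_on {z. 0 < Im z}"
        "\<And>z. 0 \<le> Im z \<Longrightarrow> cmod (F z) \<le> 2 * (K + D)" "positive_definite_fun (\<lambda>x. exp (F (of_real x)))"
      and G: "continuous_on {z. 0 \<le> Im z} G" "G holomorphic_on {z. 0 < Im z}"
        "\<And>z. 0 \<le> Im z \<Longrightarrow> cmod (G z) \<le> 2 * (K + D)" "positive_definite_fun (\<lambda>x. exp (G (of_real x)))"
      and FG: "\<And>x. \<psi> x = of_real c + F (of_real x) + G (- of_real x)"
    \<comment> \<open>The positive part of the drift goes to \<open>P\<close>, the negative part to
      \<open>Q\<close> in the reflected variable, so both characters are bounded on the upper half
      plane. The positive factor exp c could join either side.\<close>
    define P where "P x = exp (F (of_real x)) * (complex_of_real (exp c) * cis (max \<beta> 0 * x))" for x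
    define Q where "Q x = exp (G (of_real x)) * (complex_of_real 1 * cis (max (- \<beta>) 0 * x))" for x
    have "f x = P x * Q (- x)" for x
    proof -
      have "L x = of_real c + F (of_real x) + G (- of_real x) + \<i> * of_real (\<beta> * x)"
        using FG[of x] by (simp add: \<psi>_def algebra_simps)
      then have "f x = exp (of_real c) * exp (F (of_real x)) * exp (G (- of_real x)) * cis (\<beta> * x)"
        by (simp add: exp_L[symmetric] exp_add cis_conv_exp)
      also have "cis (\<beta> * x) = cis (max \<beta> 0 * x) * cis (max (- \<beta>) 0 * (- x))"
        by (simp add: cis_mult max_def)
      finally show ?thesis by (simp add: P_def Q_def exp_of_real)
    qed
    moreover have "positive_definite_fun P"
      unfolding P_def by (rule positive_definite_fun_mult_cis[OF F(4)]) simp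
    moreover have "positive_definite_fun Q"
      unfolding Q_def by (rule positive_definite_fun_mult_cis[OF G(4)]) simp
    moreover have "bounded_holomorphic_ext_upper P"
      unfolding P_def by (rule bounded_holomorphic_ext_upper_exp[OF F(1,2,3)]) simp_all
    moreover have "bounded_holomorphic_ext_upper Q"
      unfolding Q_def by (rule bounded_holomorphic_ext_upper_exp[OF G(1,2,3)]) simp_all
    ultimately show ?thesis
      using positive_definite_fun_reflect[of Q] bounded_holomorphic_ext_reflect[of Q]
      by (intro exI[of _ P] exI[of _ "\<lambda>x. Q (- x)"]) simp
  qed
qed

end
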